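(* Let $N\geqslant1$. For the Harish-Chandra images of the symmetrized invariants of $\mathfrak{gl}_N$ we have $$\chi:\varpi(\Delta_m)\mapsto\sum_{k=1}^m{m\brace k}\binom Nm\binom Nk^{-1}e^*_k(\lambda_1,\dots,\lambda_N)\qquad(1\leqslant m\leqslant N)$$ and $$\chi:\varpi(\Phi_m)\mapsto\sum_{k=1}^m{m\brace k}\binom{-N}m\binom{-N}k^{-1}h^*_k(\lambda_1,\dots,\lambda_N)\qquad(m\geqslant1).$$
   Context: $E_{ij}$ is the standard basis of $\mathfrak{gl}_N$ over $\mathbb C$. With $E=[E_{ij}]$ viewed as a matrix over the symmetric algebra $S(\mathfrak{gl}_N)$, the invariants $\Delta_k,\Phi_k\in S(\mathfrak{gl}_N)^{\mathfrak{gl}_N}$ are defined by $\det(u+E)=u^N+\Delta_1u^{N-1}+\dots+\Delta_N$ and $\det(1-qE)^{-1}=1+\sum_{k\geqslant1}\Phi_kq^k$. The symmetrization map $\varpi:S(\mathfrak{gl}_N)\to U(\mathfrak{gl}_N)$ is $x_1\cdots x_p\mapsto\frac1{p!}\sum_{\sigma\in\mathfrak S_p}x_{\sigma(1)}\cdots x_{\sigma(p)}$ for $x_i\in\mathfrak{gl}_N$; it maps invariants to central elements. For $\lambda=(\lambda_1,\dots,\lambda_N)\in\mathbb C^N$, $L(\lambda)$ is the irreducible highest weight representation of $\mathfrak{gl}_N$ generated by a nonzero vector $\xi$ with $E_{ij}\xi=0$ for $i<j$ and $E_{ii}\xi=\lambda_i\xi$. A central element $z\in U(\mathfrak{gl}_N)$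 acts on $L(\lambda)$ by a scalar $\chi(z)$, which as a polynomial in $\lambda_1,\dots,\lambda_N$ is the Harish-Chandra image of $z$. The shifted symmetric polynomials are $$e^*_m(\lambda_1,\dots,\lambda_N)=\sum_{i_1<\dots<i_m}\lambda_{i_1}(\lambda_{i_2}-1)\cdots(\lambda_{i_m}-m+1),\quad h^*_m(\lambda_1,\dots,\lambda_N)=\sum_{i_1\leqslant\dots\leqslant i_m}\lambda_{i_1}(\lambda_{i_2}+1)\cdots(\lambda_{i_m}+m-1).$$ ${m\brace k}$ is the Stirling number of the second kind: the number of partitions of $\{1,\dots,m\}$ into $k$ nonempty subsets. $\binom xk=x(x-1)\cdots(x-k+1)/k!$ for any number $x$. *)

theory Defs
  imports
    "HOL-Analysis.Analysis"
    "HOL-Library.Poly_Mapping"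
    "HOL-Computational_Algebra.Polynomial"
    "HOL-Computational_Algebra.Formal_Power_Series"
    "HOL-Combinatorics.Combinatorics"
begin

text \<open>
  Throughout, a finite linearly ordered type \<open>'n\<close> with \<open>N\<close> elements plays the role of
  the index set \<open>{1, ..., N}\<close>; as types are nonempty, \<open>N \<ge> 1\<close>.
  The pair \<open>(i, j)\<close> stands for the basis element \<open>E\<^sub>i\<^sub>j\<close>.
\<close>

section \<open>The universal enveloping algebra of \<open>gl_N\<close>\<close>

datatype 'a free_monoid = Letters "'a list"

instantiation free_monoid :: (type) monoid_add
begin

definition zero_free_monoid :: "'a free_monoid" where
  "0 = Letters []"

fun plus_free_monoid :: "'a free_monoid \<Rightarrow> 'a free_monoid \<Rightarrow> 'a free_monoid" where
  "Letters xs + Letters ys = Letters (xs @ ys)"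

instance
proof
  fix a b c :: "'a free_monoid"
  show "a + b + c = a + (b + c)" by (cases a; cases b; cases c) simp
  show "0 + a = a" by (cases a) (simp add: zero_free_monoid_def)
  show "a + 0 = a" by (cases a) (simp add: zero_free_monoid_def)
qed

end

text \<open>
  The free associative algebra on the symbols \<open>(i, j)\<close>, i.e. the tensor algebra of \<open>gl_N\<close>;
  its product is the convolution product of \<open>HOL-Library.Poly_Mapping\<close>.
\<close>

type_synonym 'n tensor_alg = "('n \<times> 'n) free_monoid \<Rightarrow>\<^sub>0 complex"

definition tensor_gen :: "'n \<Rightarrow> 'n \<Rightarrow> 'n tensor_alg" where
  "tensor_gen i j = Poly_Mapping.single (Letters [(i, j)]) 1"

text \<open>
  The two-sided ideal generated by the relations
  \<open>E\<^sub>i\<^sub>j E\<^sub>k\<^sub>l - E\<^sub>k\<^sub>l E\<^sub>i\<^sub>j = \<delta>\<^sub>k\<^sub>j E\<^sub>i\<^sub>l - \<delta>\<^sub>i\<^sub>l E\<^sub>k\<^sub>j\<close>. Since \<open>p\<close> and \<open>q\<close> are arbitrary, closure under sums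
  is all that is missing from the products below.
\<close>

inductive_set commutator_ideal :: "'n tensor_alg set" where
  relation: "p * (tensor_gen i j * tensor_gen k l - tensor_gen k l * tensor_gen i j
      - ((if k = j then tensor_gen i l else 0) - (if i = l then tensor_gen k j else 0))) * q
    \<in> commutator_ideal"
| sum: "a \<in> commutator_ideal \<Longrightarrow> b \<in> commutator_ideal \<Longrightarrow> a + b \<in> commutator_ideal"

lemma commutator_ideal_zero: "0 \<in> commutator_ideal"
  using commutator_ideal.relation[of 0] by simp

lemma commutator_ideal_mult_left: "a \<in> commutator_ideal \<Longrightarrow> c * a \<in> commutator_ideal"
proof (induction rule: commutator_ideal.induct)
  case (relation p i j k l q)
  show ?case
    using commutator_ideal.relation[of "c * p" i j k l q] by (simp only: mult.assoc)
next
  case (sum a b)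
  then show ?case by (simp add: distrib_left commutator_ideal.sum)
qed

lemma commutator_ideal_mult_right: "a \<in> commutator_ideal \<Longrightarrow> a * c \<in> commutator_ideal"
proof (induction rule: commutator_ideal.induct)
  case (relation p i j k l q)
  show ?case
    using commutator_ideal.relation[of p i j k l "q * c"] by (simp only: mult.assoc)
next
  case (sum a b)
  then show ?case by (simp add: distrib_right commutator_ideal.sum)
qed

lemma commutator_ideal_uminus: "a \<in> commutator_ideal \<Longrightarrow> - a \<in> commutator_ideal"
  using commutator_ideal_mult_left[of a "- 1"] by simp

definition ugl_rel :: "'n tensor_alg \<Rightarrow> 'n tensor_alg \<Rightarrow> bool" where
  "ugl_rel a b \<longleftrightarrow> a - b \<in> commutator_ideal"

lemma equivp_ugl_rel: "equivp (ugl_rel :: 'n tensor_alg \<Rightarrow> _)"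
proof (rule equivpI)
  show "reflp (ugl_rel :: 'n tensor_alg \<Rightarrow> _)"
    by (simp add: reflp_def ugl_rel_def commutator_ideal_zero)
  show "symp (ugl_rel :: 'n tensor_alg \<Rightarrow> _)"
    using commutator_ideal_uminus by (fastforce simp: symp_def ugl_rel_def)
  show "transp (ugl_rel :: 'n tensor_alg \<Rightarrow> _)"
  proof (rule transpI)
    fix a b c :: "'n tensor_alg"
    assume "ugl_rel a b" "ugl_rel b c"
    then have "(a - b) + (b - c) \<in> commutator_ideal"
      unfolding ugl_rel_def by (rule commutator_ideal.sum)
    then show "ugl_rel a c"
      by (simp add: ugl_rel_def)
  qed
qed

quotient_type 'n ugl = "'n tensor_alg" / ugl_rel
  by (rule equivp_ugl_rel)

instantiation ugl :: (type) ring
begin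

lift_definition zero_ugl :: "'a ugl" is 0 .

lift_definition plus_ugl :: "'a ugl \<Rightarrow> 'a ugl \<Rightarrow> 'a ugl" is "(+)"
proof -
  fix a a' b b' :: "'a tensor_alg"
  assume "ugl_rel a a'" "ugl_rel b b'"
  then have "(a - a') + (b - b') \<in> commutator_ideal"
    unfolding ugl_rel_def by (rule commutator_ideal.sum)
  then show "ugl_rel (a + b) (a' + b')"
    by (simp add: ugl_rel_def algebra_simps)
qed

lift_definition uminus_ugl :: "'a ugl \<Rightarrow> 'a ugl" is uminus
proof -
  fix a a' :: "'a tensor_alg"
  assume "ugl_rel a a'"
  then have "- (a - a') \<in> commutator_ideal"
    unfolding ugl_rel_def by (rule commutator_ideal_uminus)
  then show "ugl_rel (- a) (- a')"
    by (simp add: ugl_rel_def)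
qed

lift_definition minus_ugl :: "'a ugl \<Rightarrow> 'a ugl \<Rightarrow> 'a ugl" is "(-)"
proof -
  fix a a' b b' :: "'a tensor_alg"
  assume "ugl_rel a a'" "ugl_rel b b'"
  then have "(a - a') + - (b - b') \<in> commutator_ideal"
    unfolding ugl_rel_def by (intro commutator_ideal.sum commutator_ideal_uminus)
  then show "ugl_rel (a - b) (a' - b')"
    by (simp add: ugl_rel_def algebra_simps)
qed

lift_definition times_ugl :: "'a ugl \<Rightarrow> 'a ugl \<Rightarrow> 'a ugl" is "(*)"
proof -
  fix a a' b b' :: "'a tensor_alg"
  assume "ugl_rel a a'" "ugl_rel b b'"
  then have "(a - a') * b + a' * (b - b') \<in> commutator_ideal"
    unfolding ugl_rel_def
    by (intro commutator_ideal.sum commutator_ideal_mult_left commutator_ideal_mult_right)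
  then show "ugl_rel (a * b) (a' * b')"
    by (simp add: ugl_rel_def algebra_simps)
qed

instance
  by standard (transfer, simp add: algebra_simps ugl_rel_def commutator_ideal_zero)+

end

text \<open>The constant term is a character that vanishes on the ideal, so \<open>1 \<noteq> 0\<close> in the quotient.\<close>

lemma lookup_zero_mult:
  fixes a b :: "'n tensor_alg"
  shows "Poly_Mapping.lookup (a * b) 0 = Poly_Mapping.lookup a 0 * Poly_Mapping.lookup b 0"
proof -
  have split: "(0 = k + l) = (k = 0 \<and> l = 0)" for k l :: "('n \<times> 'n) free_monoid"
    by (cases k; cases l) (auto simp: zero_free_monoid_def)
  have "Sum_any (\<lambda>l. Poly_Mapping.lookup b l when 0 = k + l) = (Poly_Mapping.lookup b 0 when k = 0)"
    for k :: "('n \<times> 'n) free_monoid"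
    by (cases "k = 0") (simp_all add: split)
  then show ?thesis
    by (simp add: lookup_mult mult_when)
qed

lemma lookup_zero_commutator_ideal:
  "a \<in> commutator_ideal \<Longrightarrow> Poly_Mapping.lookup a 0 = 0"
proof (induction rule: commutator_ideal.induct)
  case (relation p i j k l q)
  have "Poly_Mapping.lookup (tensor_gen i' j') 0 = 0" for i' j' :: 'a
    by (simp add: tensor_gen_def lookup_single zero_free_monoid_def)
  then show ?case
    by (simp add: lookup_zero_mult lookup_minus)
next
  case (sum a b)
  then show ?case by (simp add: lookup_add)
qed

instantiation ugl :: (type) ring_1
begin

lift_definition one_ugl :: "'a ugl" is 1 .

instance
proof
  show "(0 :: 'a ugl) \<noteq> 1"
  proof transfer
    have "Poly_Mapping.lookup (0 - 1 :: 'b tensor_alg) 0 \<noteq> 0"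
      by (simp add: lookup_minus lookup_one)
    then show "\<not> ugl_rel (0 :: 'b tensor_alg) 1"
      unfolding ugl_rel_def using lookup_zero_commutator_ideal by blast
  qed
qed (transfer, simp add: ugl_rel_def commutator_ideal_zero)+

end

lift_definition ugl_const :: "complex \<Rightarrow> 'n ugl" is "Poly_Mapping.single 0" .

lift_definition ugl_gen :: "'n \<Rightarrow> 'n \<Rightarrow> 'n ugl" is tensor_gen .

lemma ugl_gen_commutator:
  "ugl_gen i j * ugl_gen k l - ugl_gen k l * ugl_gen i j
    = (if k = j then ugl_gen i l else 0) - (if i = l then ugl_gen k j else 0)"
proof -
  have eq: "(if b then ugl_gen i' j' else 0) = abs_ugl (if b then tensor_gen i' j' else 0)"
    for b and i' j' :: 'a
    by (simp add: ugl_gen.abs_eq zero_ugl.abs_eq)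
  show ?thesis
    unfolding eq
    using commutator_ideal.relation[of 1 i j k l 1]
    by (simp add: ugl_gen.abs_eq times_ugl.abs_eq minus_ugl.abs_eq ugl.abs_eq_iff ugl_rel_def)
qed

section \<open>The symmetric algebra and symmetrization\<close>

text \<open>
  \<open>S(gl_N)\<close> as the polynomial ring in the commuting variables \<open>E\<^sub>i\<^sub>j\<close>: a multiset of index
  pairs is a monomial.
\<close>

type_synonym 'n sgl = "('n \<times> 'n) multiset \<Rightarrow>\<^sub>0 complex"

definition sgl_gen :: "'n \<Rightarrow> 'n \<Rightarrow> 'n sgl" where
  "sgl_gen i j = Poly_Mapping.single {#(i, j)#} 1"

definition symmetrized_product :: "('n \<times> 'n) list \<Rightarrow> 'n ugl" where
  "symmetrized_product xs =
    ugl_const (1 / fact (length xs)) *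
    (\<Sum>\<sigma> | \<sigma> permutes {..<length xs}.
      prod_list (map (\<lambda>(i, j). ugl_gen i j) (permute_list \<sigma> xs)))"

text \<open>
  The linear extension of \<open>x\<^sub>1 ... x\<^sub>p \<mapsto> 1/p! \<Sum>\<^sub>\<sigma> x\<^bsub>\<sigma>(1)\<^esub> ... x\<^bsub>\<sigma>(p)\<^esub>\<close> from basis elements
  \<open>x\<^sub>i\<close>. The chosen enumeration of a monomial is irrelevant, see \<open>symmetrization_prod_list\<close>.
\<close>

definition symmetrization :: "'n sgl \<Rightarrow> 'n ugl" where
  "symmetrization p =
    (\<Sum>M\<in>Poly_Mapping.keys p. ugl_const (Poly_Mapping.lookup p M) *
      symmetrized_product (SOME xs. mset xs = M))"

lemma symmetrized_product_cong:
  assumes "mset xs = mset ys"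
  shows "symmetrized_product xs = symmetrized_product ys"
proof -
  from assms obtain \<pi> where \<pi>: "\<pi> permutes {..<length ys}" "permute_list \<pi> ys = xs"
    by (rule mset_eq_permutation)
  have len: "length xs = length ys"
    using assms by (rule mset_eq_length)
  define f where "f zs = prod_list (map (\<lambda>(i, j). ugl_gen i j :: 'a ugl) zs)" for zs
  have "(\<Sum>\<sigma> | \<sigma> permutes {..<length ys}. f (permute_list \<sigma> ys))
      = (\<Sum>\<sigma> | \<sigma> permutes {..<length ys}. f (permute_list (\<pi> \<circ> \<sigma>) ys))"
    using \<pi>(1) by (rule setum_permutations_compose_left)
  also have "\<dots> = (\<Sum>\<sigma> | \<sigma> permutes {..<length ys}. f (permute_list \<sigma> xs))"
    using \<pi> by (intro sum.cong) (auto simp: permute_list_compose)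
  finally show ?thesis
    by (simp add: symmetrized_product_def f_def len)
qed

lemma ugl_const_1: "ugl_const 1 = 1"
  by transfer (simp add: ugl_rel_def commutator_ideal_zero)

lemma prod_list_sgl_gen:
  "prod_list (map (\<lambda>(i, j). sgl_gen i j) xs) = Poly_Mapping.single (mset xs) 1"
  by (induction xs) (auto simp: sgl_gen_def mult_single)

lemma symmetrization_prod_list:
  "symmetrization (prod_list (map (\<lambda>(i, j). sgl_gen i j) xs)) = symmetrized_product xs"
proof -
  have "mset (SOME ys. mset ys = mset xs) = mset xs"
    by (rule someI[where P = "\<lambda>ys. mset ys = mset xs"]) simp
  then have "symmetrized_product (SOME ys. mset ys = mset xs) = symmetrized_product xs"
    by (rule symmetrized_product_cong)
  then show ?thesis
    by (simp add: prod_list_sgl_gen symmetrization_def ugl_const_1)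
qed

section \<open>The invariants\<close>

text \<open>\<open>det(u + E) = u\<^sup>N + \<Delta>\<^sub>1 u\<^bsup>N-1\<^esup> + ... + \<Delta>\<^sub>N\<close>, in polynomials in \<open>u\<close> over \<open>S(gl_N)\<close>; only meant
  for \<open>m \<le> N\<close>.\<close>

definition Delta_inv :: "nat \<Rightarrow> 'n::finite sgl" where
  "Delta_inv m =
    coeff (det (mat [:0, 1:] + (\<chi> i j. [:sgl_gen i j:]) :: 'n sgl poly ^ 'n ^ 'n)) (CARD('n) - m)"

text \<open>
  \<open>det(1 - q E)\<^sup>-\<^sup>1\<close>, in power series in \<open>q\<close> over \<open>S(gl_N)\<close>. The second argument of
  \<open>fps_right_inverse\<close> is the inverse of the constant term \<open>1\<close> of the determinant; see
  \<open>Phi_series_inverse\<close>.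
\<close>

definition Phi_det :: "'n::finite sgl fps" where
  "Phi_det = det (mat 1 - (\<chi> i j. fps_X * fps_const (sgl_gen i j)) :: 'n sgl fps ^ 'n ^ 'n)"

definition Phi_series :: "'n::finite sgl fps" where
  "Phi_series = fps_right_inverse Phi_det 1"

lemma Phi_det_nth_0: "fps_nth (Phi_det :: 'n::finite sgl fps) 0 = 1"
proof -
  define A where "A = (mat 1 - (\<chi> i j. fps_X * fps_const (sgl_gen i j)) :: 'n sgl fps ^ 'n ^ 'n)"
  have A: "fps_nth (A $ i $ j) 0 = (mat 1 :: 'n sgl ^ 'n ^ 'n) $ i $ j" for i j
    by (simp add: A_def mat_def)
  have prod: "fps_nth (prod f S) 0 = (\<Prod>i\<in>S. fps_nth (f i) 0)"
    if "finite S" for f :: "'n \<Rightarrow> 'n sgl fps" and S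
    using that by (induction S rule: finite_induct) simp_all
  have "fps_nth (det A) 0 = det (mat 1 :: 'n sgl ^ 'n ^ 'n)"
    by (simp add: det_def fps_sum_nth prod A flip: fps_of_int)
  then show ?thesis
    by (simp add: Phi_det_def A_def)
qed

lemma Phi_series_inverse: "Phi_det * Phi_series = 1"
  unfolding Phi_series_def by (rule fps_right_inverse) (simp add: Phi_det_nth_0)

definition Phi_inv :: "nat \<Rightarrow> 'n::finite sgl" where
  "Phi_inv m = fps_nth Phi_series m"

section \<open>Highest weight representations\<close>

text \<open>A representation of \<open>gl_N\<close>, given as a module over the enveloping algebra.\<close>

locale gl_module = vector_space scale
  for scale :: "complex \<Rightarrow> 'v::ab_group_add \<Rightarrow> 'v" +
  fixes act :: "'n::{finite,linorder} ugl \<Rightarrow> 'v \<Rightarrow> 'v"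
  assumes act_add_right: "act a (v + w) = act a v + act a w"
    and act_add_left: "act (a + b) v = act a v + act b v"
    and act_mult: "act (a * b) v = act a (act b v)"
    and act_const: "act (ugl_const c) v = scale c v"
begin

definition submodule :: "'v set \<Rightarrow> bool" where
  "submodule W \<longleftrightarrow> subspace W \<and> (\<forall>a. \<forall>w\<in>W. act a w \<in> W)"

end

text \<open>
  \<open>L(\<lambda>)\<close>, with \<open>\<lambda> = weight\<close>. It is determined up to isomorphism, so an element of the center
  acts on all such modules by the same scalar, the value at \<open>\<lambda>\<close> of its Harish-Chandra image.
\<close>

locale irreducible_highest_weight_module = gl_module scale act
  for scale :: "complex \<Rightarrow> 'v::ab_group_add \<Rightarrow> 'v"
    and act :: "'n::{finite,linorder} ugl \<Rightarrow> 'v \<Rightarrow> 'v" +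
  fixes weight :: "complex ^ 'n::{finite,linorder}" and \<xi> :: 'v
  assumes irreducible: "submodule W \<Longrightarrow> W = {0} \<or> W = UNIV"
    and nonzero: "\<xi> \<noteq> 0"
    and generated: "submodule W \<Longrightarrow> \<xi> \<in> W \<Longrightarrow> W = UNIV"
    and raising: "i < j \<Longrightarrow> act (ugl_gen i j) \<xi> = 0"
    and weight: "act (ugl_gen i i) \<xi> = scale (weight $ i) \<xi>"

section \<open>Shifted symmetric polynomials\<close>

text \<open>The lists \<open>js\<close> are the index tuples \<open>(i\<^sub>1, ..., i\<^sub>m)\<close>, numbered from \<open>0\<close>.\<close>

definition shifted_elementary :: "nat \<Rightarrow> complex ^ 'n::{finite,linorder} \<Rightarrow> complex" where
  "shifted_elementary m lam =
    (\<Sum>js | length js = m \<and> sorted_wrt (<) js. \<Prod>r<m. (lam $ (js ! r) - of_nat r))"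

definition shifted_complete :: "nat \<Rightarrow> complex ^ 'n::{finite,linorder} \<Rightarrow> complex" where
  "shifted_complete m lam =
    (\<Sum>js | length js = m \<and> sorted_wrt (\<le>) js. \<Prod>r<m. (lam $ (js ! r) + of_nat r))"

end

theory Submission
  imports Defs
begin

text \<open>
  Both families of invariants are traces over tensors: if \<open>A\<close> denotes the antisymmetrizer or the
  symmetrizer of \<open>(\<complex>\<^sup>N)\<^bsup>\<otimes>m\<^esup>\<close> and \<open>E\<^sub>a\<close> the matrix \<open>E\<close> in the \<open>a\<close>-th tensor factor, then \<open>\<Delta>\<^sub>m\<close> and
  \<open>\<Phi>\<^sub>m\<close> are equal to \<open>tr A E\<^sub>1 ... E\<^sub>m\<close>. A sign \<open>\<eta>\<close>, which is \<open>-1\<close> for the antisymmetrizer and \<open>1\<close> for the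
  symmetrizer, lets both cases run in parallel throughout.

  Since \<open>A\<close> commutes with permutations of the tensor factors, symmetrization sends such a trace to the
  expression \<open>tr A E\<^sub>1 ... E\<^sub>m\<close> formed in the enveloping algebra (\<open>symmetrization_shifted_trace\<close>), and since \<open>A\<close>
  commutes with \<open>gl_N\<close>, the latter is central (\<open>shifted_trace_commute\<close>). It hence acts on \<open>L(\<lambda>)\<close> by the
  scalar by which it acts on the highest weight vector \<open>\<xi>\<close>.

  Without shifts this scalar is not visible, but with the shifts of the Capelli identity it is:
  \<open>tr A E\<^sub>1 (E\<^sub>2 + \<eta>) ... (E\<^sub>k + (k - 1) \<eta>)\<close> is a sum of column determinants or permanents that are
  symmetric under simultaneous permutations of rows and columns (\<open>capelli_mset_eq\<close>). One may therefore
  order the columns increasingly, and then in the action on \<open>\<xi>\<close>, from right to left, only diagonal entries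
  survive (\<open>act_word_sum\<close>). The result is \<open>e*\<^sub>k(\<lambda>)\<close> or \<open>h*\<^sub>k(\<lambda>)\<close> (\<open>act_shifted_trace\<close>).

  The two kinds of traces are related by the partial trace of \<open>A\<close> over one factor, which is a multiple of
  the (anti)symmetrizer of the remaining ones (\<open>kron_trace\<close>). Normalized by the trace of \<open>A\<close>, which is
  \<open>\<plusminus>\<close> a binomial coefficient of \<open>\<plusminus>N\<close>, a trace with shifts \<open>c\<^sub>1, ..., c\<^sub>m\<close> depends linearly on the
  polynomial \<open>(x + c\<^sub>1) ... (x + c\<^sub>m)\<close>. The expansion of \<open>x\<^sup>m\<close> into factorials then gives the Stirling
  numbers, with the quotients of binomial coefficients from the normalization
  (\<open>shifted_trace_unshifted\<close>).

  That \<open>\<Delta>\<^sub>m\<close> is such a trace follows from the same principle, with \<open>(x + u)\<^sup>N\<close> in place of \<open>x\<^sup>m\<close>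
  (\<open>det_shift_expansion\<close>). For \<open>\<Phi>\<^sub>m\<close> it is MacMahon's master theorem (\<open>Phi_inv_eq\<close>), which follows from the
  Newton identities for the two families of traces (\<open>newton_identity\<close>).
\<close>

section \<open>Sums over tuples\<close>

definition tuples :: "nat \<Rightarrow> 'a list set" where
  "tuples m = {xs. length xs = m}"

lemma finite_tuples [simp]: "finite (tuples m :: 'a::finite list set)"
  using finite_lists_length_eq[of "UNIV :: 'a set" m] by (simp add: tuples_def)

lemma tuples_0 [simp]: "tuples 0 = {[]}"
  by (auto simp: tuples_def)

lemma sum_tuples_append:
  fixes F :: "'a::finite list \<Rightarrow> 'b::comm_monoid_add"
  shows "(\<Sum>xs\<in>tuples (m + n). F xs) = (\<Sum>xs\<in>tuples m. \<Sum>ys\<in>tuples n. F (xs @ ys))"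
proof -
  have inj: "inj_on (\<lambda>(xs, ys). xs @ ys) (tuples m \<times> tuples n :: ('a list \<times> 'a list) set)"
    by (auto simp: inj_on_def tuples_def)
  have "tuples (m + n) = (\<lambda>(xs, ys). xs @ ys) ` (tuples m \<times> tuples n :: ('a list \<times> 'a list) set)"
  proof (intro equalityI subsetI)
    fix zs :: "'a list"
    assume "zs \<in> tuples (m + n)"
    then have "zs = (\<lambda>(xs, ys). xs @ ys) (take m zs, drop m zs)"
      "(take m zs, drop m zs) \<in> tuples m \<times> tuples n"
      by (auto simp: tuples_def)
    then show "zs \<in> (\<lambda>(xs, ys). xs @ ys) ` (tuples m \<times> tuples n)"
      by (rule image_eqI)
  qed (auto simp: tuples_def)
  then have "(\<Sum>xs\<in>tuples (m + n). F xs) = (\<Sum>p\<in>tuples m \<times> tuples n. (F \<circ> (\<lambda>(xs, ys). xs @ ys)) p)"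
    by (metis sum.reindex[OF inj])
  then show ?thesis
    by (simp add: sum.cartesian_product case_prod_unfold)
qed

lemma sum_tuples_1:
  fixes F :: "'a::finite list \<Rightarrow> 'b::comm_monoid_add"
  shows "(\<Sum>xs\<in>tuples (Suc 0). F xs) = (\<Sum>x\<in>UNIV. F [x])"
proof -
  have "tuples (Suc 0) = (\<lambda>x. [x]) ` (UNIV :: 'a set)"
    by (auto simp: tuples_def length_Suc_conv)
  then show ?thesis
    by (simp add: sum.reindex inj_on_def)
qed

lemma sum_tuples_Suc:
  fixes F :: "'a::finite list \<Rightarrow> 'b::comm_monoid_add"
  shows "(\<Sum>xs\<in>tuples (Suc m). F xs) = (\<Sum>x\<in>UNIV. \<Sum>xs\<in>tuples m. F (x # xs))"
  using sum_tuples_append[of F "Suc 0" m] by (simp add: sum_tuples_1)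

lemma sum_tuples_snoc:
  fixes F :: "'a::finite list \<Rightarrow> 'b::comm_monoid_add"
  shows "(\<Sum>xs\<in>tuples (Suc m). F xs) = (\<Sum>xs\<in>tuples m. \<Sum>x\<in>UNIV. F (xs @ [x]))"
  using sum_tuples_append[of F m "Suc 0"] by (simp add: sum_tuples_1)

lemma sum_tuples_insert:
  fixes F :: "'a::finite list \<Rightarrow> 'b::comm_monoid_add"
  shows "(\<Sum>xs\<in>tuples (Suc (m + n)). F xs)
    = (\<Sum>xs\<in>tuples m. \<Sum>ys\<in>tuples n. \<Sum>x\<in>UNIV. F (xs @ x # ys))"
proof -
  have "(\<Sum>x\<in>UNIV. \<Sum>ys\<in>tuples n. F (xs @ x # ys))
      = (\<Sum>ys\<in>tuples n. \<Sum>x\<in>UNIV. F (xs @ x # ys))" for xs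
    by (rule sum.swap)
  then show ?thesis
    using sum_tuples_append[of F m "Suc n"] by (simp add: sum_tuples_Suc)
qed

lemma sum_tuples_pairs:
  fixes F :: "('a::finite \<times> 'b::finite) list \<Rightarrow> 'c::comm_monoid_add"
  shows "(\<Sum>zs\<in>tuples m. F zs) = (\<Sum>f\<in>tuples m. \<Sum>g\<in>tuples m. F (zip f g))"
proof (induction m arbitrary: F)
  case (Suc m)
  have pairs: "(\<Sum>p\<in>UNIV. G p) = (\<Sum>i\<in>UNIV. \<Sum>j\<in>UNIV. G (i, j))" for G :: "'a \<times> 'b \<Rightarrow> 'c"
    by (simp add: sum.cartesian_product)
  have "(\<Sum>zs\<in>tuples (Suc m). F zs) = (\<Sum>i\<in>UNIV. \<Sum>j\<in>UNIV. \<Sum>zs\<in>tuples m. F ((i, j) # zs))"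
    by (simp only: sum_tuples_Suc pairs)
  also have "\<dots> = (\<Sum>i\<in>UNIV. \<Sum>j\<in>UNIV. \<Sum>f\<in>tuples m. \<Sum>g\<in>tuples m. F ((i, j) # zip f g))"
    by (simp add: Suc.IH)
  also have "\<dots> = (\<Sum>i\<in>UNIV. \<Sum>f\<in>tuples m. \<Sum>j\<in>UNIV. \<Sum>g\<in>tuples m. F ((i, j) # zip f g))"
    by (intro sum.cong refl sum.swap)
  finally show ?case
    by (simp add: sum_tuples_Suc)
qed simp

lemma sum_tuples_Suc2:
  fixes F :: "'a::finite list \<Rightarrow> 'b::finite list \<Rightarrow> 'c::comm_monoid_add"
  shows "(\<Sum>f\<in>tuples (Suc m). \<Sum>g\<in>tuples (Suc m). F f g)
    = (\<Sum>i\<in>UNIV. \<Sum>j\<in>UNIV. \<Sum>f\<in>tuples m. \<Sum>g\<in>tuples m. F (i # f) (j # g))"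
proof -
  have "(\<Sum>f\<in>tuples m. \<Sum>j\<in>UNIV. \<Sum>g\<in>tuples m. F (i # f) (j # g))
      = (\<Sum>j\<in>UNIV. \<Sum>f\<in>tuples m. \<Sum>g\<in>tuples m. F (i # f) (j # g))" for i
    by (rule sum.swap)
  then show ?thesis by (simp add: sum_tuples_Suc)
qed

section \<open>The generalized Kronecker delta\<close>

text \<open>
  The transpose of an annihilation operator, which is fermionic for \<open>\<eta> = -1\<close> and bosonic for \<open>\<eta> = 1\<close>:
  the letter \<open>i\<close> is cut out of \<open>g\<close> at each of its positions, with one factor \<open>\<eta>\<close> for every letter that
  it passes on its way to the front, and \<open>\<phi>\<close> is evaluated at what remains.
\<close>

primrec contract :: "int \<Rightarrow> 'n \<Rightarrow> ('n list \<Rightarrow> int) \<Rightarrow> 'n list \<Rightarrow> int" where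
  "contract \<eta> i \<phi> [] = 0"
| "contract \<eta> i \<phi> (j # g) =
    (if i = j then \<phi> g else 0) + \<eta> * contract \<eta> i (\<lambda>h. \<phi> (j # h)) g"

text \<open>
  The matrix entries of \<open>m!\<close> times the antisymmetrizer (\<open>\<eta> = -1\<close>) or the symmetrizer (\<open>\<eta> = 1\<close>) of
  \<open>(\<complex>\<^sup>N)\<^bsup>\<otimes>m\<^esup>\<close>, that is, the determinant or the permanent of the matrix of Kronecker deltas between the
  letters of two words. The recursion is the Laplace expansion along the first row, which is
  uniform in \<open>\<eta>\<close>.
\<close>

primrec kron :: "int \<Rightarrow> 'n list \<Rightarrow> 'n list \<Rightarrow> int" where
  "kron \<eta> [] = (\<lambda>g. if g = [] then 1 else 0)"
| "kron \<eta> (i # f) = contract \<eta> i (kron \<eta> f)"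

text \<open>
  Exchange of two neighbouring letters multiplies \<open>\<phi>\<close> by \<open>\<eta>\<close>. Neighbouring exchanges generate all
  permutations, so this is full symmetry or antisymmetry.
\<close>

definition swap_covariant :: "int \<Rightarrow> ('b list \<Rightarrow> 'a::ring_1) \<Rightarrow> bool" where
  "swap_covariant \<eta> \<phi> \<longleftrightarrow> (\<forall>h a b g. \<phi> (h @ a # b # g) = of_int \<eta> * \<phi> (h @ b # a # g))"

lemma swap_covariantD:
  "swap_covariant \<eta> \<phi> \<Longrightarrow> \<phi> (h @ a # b # g) = of_int \<eta> * \<phi> (h @ b # a # g)"
  unfolding swap_covariant_def by blast

lemma swap_covariant_Cons:
  assumes "swap_covariant \<eta> \<phi>"
  shows "swap_covariant \<eta> (\<lambda>h. \<phi> (j # h))"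
  unfolding swap_covariant_def
proof (intro allI)
  fix h a b g
  show "\<phi> (j # h @ a # b # g) = of_int \<eta> * \<phi> (j # h @ b # a # g)"
    using swap_covariantD[OF assms, of "j # h" a b g] by simp
qed

lemma contract_lin:
  "contract \<eta> i (\<lambda>h. a * \<phi> h + b * \<psi> h) g = a * contract \<eta> i \<phi> g + b * contract \<eta> i \<psi> g"
  by (induction g arbitrary: \<phi> \<psi>) (simp_all add: algebra_simps)

lemma contract_scale: "contract \<eta> i (\<lambda>h. a * \<phi> h) g = a * contract \<eta> i \<phi> g"
  using contract_lin[of \<eta> i a \<phi> 0 \<phi>] by simp

lemma contract_add: "contract \<eta> i (\<lambda>h. \<phi> h + \<psi> h) g = contract \<eta> i \<phi> g + contract \<eta> i \<psi> g"
  using contract_lin[of \<eta> i 1 \<phi> 1 \<psi>] by simp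

lemma contract_zero [simp]: "contract \<eta> i (\<lambda>h. 0) g = 0"
  using contract_scale[of \<eta> i 0] by simp

lemma contract_if:
  "contract \<eta> i (\<lambda>h. if P then \<phi> h else 0) g = (if P then contract \<eta> i \<phi> g else 0)"
  by simp

text \<open>
  The (anti)commutation relation of the annihilation operators. It is what makes the Laplace
  expansion symmetric in its rows.
\<close>

lemma contract_commute:
  assumes "\<eta> * \<eta> = 1"
  shows "contract \<eta> i (contract \<eta> j \<phi>) g = \<eta> * contract \<eta> j (contract \<eta> i \<phi>) g"
proof (induction g arbitrary: \<phi>)
  case (Cons k g)
  have step: "contract \<eta> i (contract \<eta> j \<phi>) (k # g)
      = (if i = k then contract \<eta> j \<phi> g else 0) + \<eta> * (if j = k then contract \<eta> i \<phi> g else 0)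
        + contract \<eta> i (contract \<eta> j (\<lambda>h. \<phi> (k # h))) g" for i j
  proof -
    have "contract \<eta> i (contract \<eta> j \<phi>) (k # g)
      = (if i = k then contract \<eta> j \<phi> g else 0) + \<eta> * (if j = k then contract \<eta> i \<phi> g else 0)
        + (\<eta> * \<eta>) * contract \<eta> i (contract \<eta> j (\<lambda>h. \<phi> (k # h))) g"
      by (simp add: contract_add contract_scale contract_if algebra_simps)
    then show ?thesis by (simp add: assms)
  qed
  have "\<eta> * (\<eta> * x) = x" for x
    by (metis assms mult.assoc mult_1)
  then show ?case
    unfolding step by (simp add: Cons.IH algebra_simps)
qed simp

lemma swap_covariant_contract:
  assumes "\<eta> * \<eta> = 1" "swap_covariant \<eta> \<phi>"
  shows "swap_covariant \<eta> (contract \<eta> i \<phi>)"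
  unfolding swap_covariant_def
proof (intro allI)
  fix h a b g
  have inv: "\<eta> * (\<eta> * x) = x" for x
    by (metis assms(1) mult.assoc mult_1)
  show "contract \<eta> i \<phi> (h @ a # b # g) = of_int \<eta> * contract \<eta> i \<phi> (h @ b # a # g)"
    using assms(2)
  proof (induction h arbitrary: \<phi>)
    case Nil
    have swap: "\<phi> (a # b # h) = \<eta> * \<phi> (b # a # h)" for h
      using swap_covariantD[OF Nil, of "[]" a b h] by simp
    then have "contract \<eta> i (\<lambda>h. \<phi> (a # b # h)) g = \<eta> * contract \<eta> i (\<lambda>h. \<phi> (b # a # h)) g"
      by (simp only: contract_scale)
    then show ?case
      by (simp add: algebra_simps inv)
  next
    case (Cons k h)
    show ?case
      using Cons.IH[OF swap_covariant_Cons[OF Cons.prems, of k]] swap_covariantD[OF Cons.prems, of h a b g]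
      by (simp add: algebra_simps)
  qed
qed

lemma swap_covariant_kron_right:
  assumes "\<eta> * \<eta> = 1"
  shows "swap_covariant \<eta> (kron \<eta> f)"
proof (induction f)
  case Nil
  show ?case by (simp add: swap_covariant_def)
next
  case (Cons i f)
  then show ?case by (simp add: swap_covariant_contract[OF assms])
qed

lemma swap_covariant_kron_left:
  assumes "\<eta> * \<eta> = 1"
  shows "swap_covariant \<eta> (\<lambda>f. kron \<eta> f g)"
  unfolding swap_covariant_def
proof (intro allI)
  fix h a b f
  show "kron \<eta> (h @ a # b # f) g = of_int \<eta> * kron \<eta> (h @ b # a # f) g"
  proof (induction h arbitrary: g)
    case Nil
    show ?case using contract_commute[OF assms, of a b] by simp
  next
    case (Cons k h)
    then have "kron \<eta> (h @ a # b # f) = (\<lambda>g. \<eta> * kron \<eta> (h @ b # a # f) g)"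
      by (simp add: fun_eq_iff)
    then show ?case by (simp add: contract_scale)
  qed
qed

lemma contract_support:
  assumes "contract \<eta> i \<phi> g \<noteq> 0"
  shows "\<exists>h. \<phi> h \<noteq> 0 \<and> mset g = add_mset i (mset h)"
  using assms
proof (induction g arbitrary: \<phi>)
  case (Cons j g)
  show ?case
  proof (cases "i = j \<and> \<phi> g \<noteq> 0")
    case False
    then have "contract \<eta> i (\<lambda>h. \<phi> (j # h)) g \<noteq> 0"
      using Cons.prems by (auto split: if_splits)
    then obtain h where "\<phi> (j # h) \<noteq> 0" "mset g = add_mset i (mset h)"
      using Cons.IH by blast
    then show ?thesis
      by (intro exI[of _ "j # h"]) simp
  qed auto
qed simp

lemma kron_support: "kron \<eta> f g \<noteq> 0 \<Longrightarrow> mset f = mset g"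
proof (induction f arbitrary: g)
  case (Cons i f)
  then show ?case using contract_support[of \<eta> i "kron \<eta> f" g] by auto
qed (auto split: if_splits)

text \<open>
  A letter that moves to the front passes every letter of \<open>h\<close> once.
\<close>

lemma swap_covariant_move:
  assumes "\<eta> * \<eta> = 1" "swap_covariant \<eta> \<phi>"
  shows "\<phi> (h @ i # g) = of_int (\<eta> ^ length h) * \<phi> (i # h @ g)"
proof -
  have "\<phi> (k @ h @ i # g) = of_int (\<eta> ^ length h) * \<phi> (k @ i # h @ g)" for k
  proof (induction h arbitrary: k)
    case (Cons a h)
    show ?case
      using Cons[of "k @ [a]"] swap_covariantD[OF assms(2), of k a i "h @ g"]
      by (simp add: mult.assoc [symmetric] power_commutes)
  qed simp
  from this[of "[]"] show ?thesis by simp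
qed

text \<open>
  The Euler operator: putting a letter back after its removal, summed over the letters, counts the
  letters. Both factors \<open>\<eta>\<close> from passing the first letter cancel in the induction.
\<close>

lemma euler_contract:
  fixes g :: "'n::finite list"
  assumes "\<eta> * \<eta> = 1" "swap_covariant \<eta> \<phi>"
  shows "(\<Sum>i\<in>UNIV. contract \<eta> i (\<lambda>h. \<phi> (i # h)) g) = int (length g) * \<phi> g"
  using assms(2)
proof (induction g arbitrary: \<phi>)
  case (Cons j g)
  have inv: "\<eta> * (\<eta> * x) = x" for x
    by (metis assms(1) mult.assoc mult_1)
  have "(\<Sum>i\<in>UNIV. contract \<eta> i (\<lambda>h. \<phi> (i # h)) (j # g))
      = \<phi> (j # g) + (\<Sum>i\<in>UNIV. \<eta> * contract \<eta> i (\<lambda>h. \<phi> (i # j # h)) g)"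
    by (simp add: sum.distrib)
  also have "(\<Sum>i\<in>UNIV. \<eta> * contract \<eta> i (\<lambda>h. \<phi> (i # j # h)) g)
      = (\<Sum>i\<in>UNIV. contract \<eta> i (\<lambda>h. \<phi> (j # i # h)) g)"
  proof (intro sum.cong refl)
    fix i
    have "\<phi> (i # j # h) = \<eta> * \<phi> (j # i # h)" for h
      using swap_covariantD[OF Cons.prems, of "[]" i j h] by simp
    then have "contract \<eta> i (\<lambda>h. \<phi> (i # j # h)) g = \<eta> * contract \<eta> i (\<lambda>h. \<phi> (j # i # h)) g"
      by (simp only: contract_scale)
    then show "\<eta> * contract \<eta> i (\<lambda>h. \<phi> (i # j # h)) g = contract \<eta> i (\<lambda>h. \<phi> (j # i # h)) g"
      by (simp only: inv)
  qed
  also have "\<dots> = int (length g) * \<phi> (j # g)"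
    using Cons.IH[OF swap_covariant_Cons[OF Cons.prems]] .
  finally show ?case by (simp add: algebra_simps)
qed simp

text \<open>
  The partial trace of the (anti)symmetrizer over one tensor factor. Moving the contracted position to
  the front in both words costs the same sign twice; there the Laplace expansion gives one term with
  a free index, hence \<open>N\<close>, and the Euler operator counts the other ones.
\<close>

lemma kron_trace:
  fixes f1 :: "'n::finite list"
  assumes \<eta>: "\<eta> * \<eta> = 1" and len: "length f1 = length g1" "length f2 = length g2"
  shows "(\<Sum>i\<in>UNIV. kron \<eta> (f1 @ i # f2) (g1 @ i # g2))
    = (int CARD('n) + \<eta> * int (length f1 + length f2)) * kron \<eta> (f1 @ f2) (g1 @ g2)"
proof -
  have pow: "\<eta> ^ k * \<eta> ^ k = 1" for k
    by (metis \<eta> power_mult_distrib power_one)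
  have "kron \<eta> (f1 @ i # f2) (g1 @ i # g2) = kron \<eta> (i # f1 @ f2) (i # g1 @ g2)" for i
  proof -
    have "kron \<eta> (f1 @ i # f2) (g1 @ i # g2) = \<eta> ^ length f1 * kron \<eta> (i # f1 @ f2) (g1 @ i # g2)"
      using swap_covariant_move[OF \<eta> swap_covariant_kron_left[OF \<eta>, of "g1 @ i # g2"], of f1 i f2]
      by simp
    also have "kron \<eta> (i # f1 @ f2) (g1 @ i # g2) = \<eta> ^ length g1 * kron \<eta> (i # f1 @ f2) (i # g1 @ g2)"
      using swap_covariant_move[OF \<eta> swap_covariant_kron_right[OF \<eta>, of "i # f1 @ f2"], of g1 i g2]
      by simp
    finally show ?thesis
      by (simp only: len mult.assoc[symmetric] pow mult_1_left)
  qed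
  then have "(\<Sum>i\<in>UNIV. kron \<eta> (f1 @ i # f2) (g1 @ i # g2))
      = (\<Sum>i\<in>UNIV. kron \<eta> (f1 @ f2) (g1 @ g2)
          + \<eta> * contract \<eta> i (\<lambda>h. kron \<eta> (f1 @ f2) (i # h)) (g1 @ g2))"
    by simp
  also have "\<dots> = int CARD('n) * kron \<eta> (f1 @ f2) (g1 @ g2)
      + \<eta> * (\<Sum>i\<in>UNIV. contract \<eta> i (\<lambda>h. kron \<eta> (f1 @ f2) (i # h)) (g1 @ g2))"
    by (simp add: sum.distrib sum_distrib_left)
  also have "\<dots> = (int CARD('n) + \<eta> * int (length f1 + length f2)) * kron \<eta> (f1 @ f2) (g1 @ g2)"
    by (simp add: euler_contract[OF \<eta> swap_covariant_kron_right[OF \<eta>]] len algebra_simps)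
  finally show ?thesis .
qed

text \<open>
  Neighbouring exchanges suffice to sort a list.
\<close>

lemma swap_invariant_mset_eq:
  assumes "\<And>h a b g. \<phi> (h @ a # b # g) = \<phi> (h @ b # a # g)" and "mset xs = mset ys"
  shows "\<phi> xs = \<phi> ys"
proof -
  have move: "\<phi> (k @ i # h @ g) = \<phi> (k @ h @ i # g)" for k i h g
  proof (induction h arbitrary: k)
    case (Cons a h)
    show ?case using Cons[of "k @ [a]"] assms(1)[of k i a "h @ g"] by simp
  qed simp
  have "\<phi> (k @ xs) = \<phi> (k @ ys)" for k
    using assms(2)
  proof (induction xs arbitrary: ys k)
    case (Cons x xs)
    then have "x \<in> set ys" by (metis list.set_intros(1) mset_eq_setD)
    then obtain h g where ys: "ys = h @ x # g" by (meson split_list)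
    with Cons.prems have "mset xs = mset (h @ g)" by simp
    then show ?case
      using Cons.IH[of "h @ g" "k @ [x]"] move[of k x h g] by (simp add: ys)
  qed simp
  from this[of "[]"] show ?thesis by simp
qed

section \<open>Shifted traces\<close>

text \<open>
  The product \<open>(X + c\<^sub>1)\<^bsub>f\<^sub>1 g\<^sub>1\<^esub> (X + c\<^sub>2)\<^bsub>f\<^sub>2 g\<^sub>2\<^esub> ...\<close> of entries of shifted matrices, in this order.
\<close>

definition word :: "('n \<Rightarrow> 'n \<Rightarrow> 'a::ring_1) \<Rightarrow> 'a list \<Rightarrow> 'n list \<Rightarrow> 'n list \<Rightarrow> 'a" where
  "word X cs f g =
    prod_list (map (\<lambda>(c, i, j). X i j + (if i = j then c else 0)) (zip cs (zip f g)))"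

lemma word_Nil [simp]: "word X [] f g = 1"
  by (simp add: word_def)

lemma word_Cons [simp]:
  "word X (c # cs) (i # f) (j # g) = (X i j + (if i = j then c else 0)) * word X cs f g"
  by (simp add: word_def)

lemma word_append:
  "length f1 = length cs1 \<Longrightarrow> length g1 = length cs1 \<Longrightarrow>
    word X (cs1 @ cs2) (f1 @ f2) (g1 @ g2) = word X cs1 f1 g1 * word X cs2 f2 g2"
  by (simp add: word_def)

text \<open>
  With \<open>A\<close> the (anti)symmetrizer this is \<open>m! tr A (X\<^sub>1 + c\<^sub>1) ... (X\<^sub>m + c\<^sub>m)\<close>, where \<open>X\<^sub>a\<close> is the matrix \<open>X\<close>
  in the \<open>a\<close>-th tensor factor.
\<close>

definition shifted_trace :: "int \<Rightarrow> ('n::finite \<Rightarrow> 'n \<Rightarrow> 'a::ring_1) \<Rightarrow> 'a list \<Rightarrow> 'a" where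
  "shifted_trace \<eta> X cs =
    (\<Sum>f\<in>tuples (length cs). \<Sum>g\<in>tuples (length cs). of_int (kron \<eta> f g) * word X cs f g)"

text \<open>
  The trace is affine in each shift. The coefficient of \<open>d\<close> has a unit matrix in one tensor factor, so
  that factor can be traced out by \<open>kron_trace\<close>, at any position of the word: this is why the shifts can
  be changed one by one although the entries of \<open>X\<close> do not commute.
\<close>

lemma shifted_trace_shift:
  fixes X :: "'n::finite \<Rightarrow> 'n \<Rightarrow> 'a::ring_1"
  assumes \<eta>: "\<eta> * \<eta> = 1" and central: "\<And>a. d * a = a * d"
  shows "shifted_trace \<eta> X (cs1 @ (c + d) # cs2) = shifted_trace \<eta> X (cs1 @ c # cs2)
    + d * of_int (int CARD('n) + \<eta> * int (length (cs1 @ cs2))) * shifted_trace \<eta> X (cs1 @ cs2)"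
proof -
  define m n where "m = length cs1" and "n = length cs2"
  define K where "K = of_int (int CARD('n) + \<eta> * int (m + n)) * d"
  let ?A = "\<lambda>f g. word X cs1 f g" and ?B = "\<lambda>f g. word X cs2 f g"
  have expand: "shifted_trace \<eta> X (cs1 @ e # cs2)
      = (\<Sum>f1\<in>tuples m. \<Sum>f2\<in>tuples n. \<Sum>i\<in>UNIV. \<Sum>g1\<in>tuples m. \<Sum>g2\<in>tuples n. \<Sum>j\<in>UNIV.
          of_int (kron \<eta> (f1 @ i # f2) (g1 @ j # g2))
            * (?A f1 g1 * ((X i j + (if i = j then e else 0)) * ?B f2 g2)))" for e
    unfolding shifted_trace_def length_append list.size(4) m_def[symmetric] n_def[symmetric]
      add_Suc_right add_0_right One_nat_def sum_tuples_insert
    by (intro sum.cong refl) (simp add: word_append tuples_def m_def)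
  have "shifted_trace \<eta> X (cs1 @ (c + d) # cs2) = shifted_trace \<eta> X (cs1 @ c # cs2)
      + (\<Sum>f1\<in>tuples m. \<Sum>f2\<in>tuples n. \<Sum>i\<in>UNIV. \<Sum>g1\<in>tuples m. \<Sum>g2\<in>tuples n. \<Sum>j\<in>UNIV.
          (if i = j then of_int (kron \<eta> (f1 @ i # f2) (g1 @ i # g2)) * d * (?A f1 g1 * ?B f2 g2)
            else 0))"
    unfolding expand sum.distrib[symmetric]
  proof (intro sum.cong refl)
    fix f1 f2 i g1 g2 j
    have "?A f1 g1 * (d * ?B f2 g2) = d * (?A f1 g1 * ?B f2 g2)"
      by (metis central mult.assoc)
    then show "of_int (kron \<eta> (f1 @ i # f2) (g1 @ j # g2))
          * (?A f1 g1 * ((X i j + (if i = j then c + d else 0)) * ?B f2 g2))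
        = of_int (kron \<eta> (f1 @ i # f2) (g1 @ j # g2))
          * (?A f1 g1 * ((X i j + (if i = j then c else 0)) * ?B f2 g2))
          + (if i = j then of_int (kron \<eta> (f1 @ i # f2) (g1 @ i # g2)) * d * (?A f1 g1 * ?B f2 g2)
            else 0)"
      by (simp add: distrib_left distrib_right mult.assoc)
  qed
  also have "(\<Sum>f1\<in>tuples m. \<Sum>f2\<in>tuples n. \<Sum>i\<in>UNIV. \<Sum>g1\<in>tuples m. \<Sum>g2\<in>tuples n. \<Sum>j\<in>UNIV.
          (if i = j then of_int (kron \<eta> (f1 @ i # f2) (g1 @ i # g2)) * d * (?A f1 g1 * ?B f2 g2)
            else 0))
      = (\<Sum>f1\<in>tuples m. \<Sum>f2\<in>tuples n. \<Sum>g1\<in>tuples m. \<Sum>g2\<in>tuples n. \<Sum>i\<in>UNIV.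
          of_int (kron \<eta> (f1 @ i # f2) (g1 @ i # g2)) * d * (?A f1 g1 * ?B f2 g2))"
  proof (intro sum.cong refl)
    fix f1 f2 :: "'n list"
    let ?t = "\<lambda>i g1 g2. of_int (kron \<eta> (f1 @ i # f2) (g1 @ i # g2)) * d * (?A f1 g1 * ?B f2 g2)"
    have "(\<Sum>i\<in>UNIV. \<Sum>g1\<in>tuples m. \<Sum>g2\<in>tuples n. ?t i g1 g2)
        = (\<Sum>g1\<in>tuples m. \<Sum>i\<in>UNIV. \<Sum>g2\<in>tuples n. ?t i g1 g2)"
      by (rule sum.swap)
    also have "\<dots> = (\<Sum>g1\<in>tuples m. \<Sum>g2\<in>tuples n. \<Sum>i\<in>UNIV. ?t i g1 g2)"
      by (intro sum.cong refl sum.swap)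
    finally show "(\<Sum>i\<in>UNIV. \<Sum>g1\<in>tuples m. \<Sum>g2\<in>tuples n. \<Sum>j\<in>UNIV. (if i = j then ?t i g1 g2 else 0))
        = (\<Sum>g1\<in>tuples m. \<Sum>g2\<in>tuples n. \<Sum>i\<in>UNIV. ?t i g1 g2)"
      by simp
  qed
  also have "\<dots> = (\<Sum>f1\<in>tuples m. \<Sum>f2\<in>tuples n. \<Sum>g1\<in>tuples m. \<Sum>g2\<in>tuples n.
          K * (of_int (kron \<eta> (f1 @ f2) (g1 @ g2)) * word X (cs1 @ cs2) (f1 @ f2) (g1 @ g2)))"
  proof (intro sum.cong refl)
    fix f1 f2 g1 g2 :: "'n list"
    assume len: "f1 \<in> tuples m" "f2 \<in> tuples n" "g1 \<in> tuples m" "g2 \<in> tuples n"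
    have "(\<Sum>i\<in>UNIV. of_int (kron \<eta> (f1 @ i # f2) (g1 @ i # g2)) * d * (?A f1 g1 * ?B f2 g2))
        = of_int (\<Sum>i\<in>UNIV. kron \<eta> (f1 @ i # f2) (g1 @ i # g2)) * d * (?A f1 g1 * ?B f2 g2)"
      by (simp add: sum_distrib_right)
    also have "(\<Sum>i\<in>UNIV. kron \<eta> (f1 @ i # f2) (g1 @ i # g2))
        = (int CARD('n) + \<eta> * int (m + n)) * kron \<eta> (f1 @ f2) (g1 @ g2)"
      using kron_trace[OF \<eta>, of f1 g1 f2 g2] len by (simp add: tuples_def)
    also have "of_int ((int CARD('n) + \<eta> * int (m + n)) * kron \<eta> (f1 @ f2) (g1 @ g2)) * d * (?A f1 g1 * ?B f2 g2)
        = K * (of_int (kron \<eta> (f1 @ f2) (g1 @ g2)) * (?A f1 g1 * ?B f2 g2))"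
      by (simp only: K_def of_int_mult mult.assoc central)
    finally have "(\<Sum>i\<in>UNIV. of_int (kron \<eta> (f1 @ i # f2) (g1 @ i # g2)) * d * (?A f1 g1 * ?B f2 g2))
        = K * (of_int (kron \<eta> (f1 @ f2) (g1 @ g2)) * (?A f1 g1 * ?B f2 g2))" .
    moreover have "word X (cs1 @ cs2) (f1 @ f2) (g1 @ g2) = ?A f1 g1 * ?B f2 g2"
      using len by (simp add: word_append tuples_def m_def)
    ultimately show "(\<Sum>i\<in>UNIV. of_int (kron \<eta> (f1 @ i # f2) (g1 @ i # g2)) * d * (?A f1 g1 * ?B f2 g2))
      = K * (of_int (kron \<eta> (f1 @ f2) (g1 @ g2)) * word X (cs1 @ cs2) (f1 @ f2) (g1 @ g2))"
      by (simp only:)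
  qed
  also have "\<dots> = K * (\<Sum>f1\<in>tuples m. \<Sum>f2\<in>tuples n. \<Sum>g1\<in>tuples m. \<Sum>g2\<in>tuples n.
          of_int (kron \<eta> (f1 @ f2) (g1 @ g2)) * word X (cs1 @ cs2) (f1 @ f2) (g1 @ g2))"
    by (simp only: sum_distrib_left)
  also have "\<dots> = K * shifted_trace \<eta> X (cs1 @ cs2)"
    by (simp add: shifted_trace_def sum_tuples_append m_def n_def)
  finally show ?thesis
    by (simp add: K_def m_def n_def central)
qed

text \<open>
  After division by \<open>\<Prod>r<k + j. N + \<eta> r\<close> the recursion for \<open>V k j\<close> is the one that the multiplication by
  \<open>x\<close> obeys on \<open>x (x + \<eta>) ... (x + (k - 1) \<eta>) x\<^sup>j\<close>. The expansion of \<open>V 0 m\<close> is therefore that of the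
  monomial \<open>x\<^sup>m\<close> in (rising or falling) factorials, which is given by Stirling numbers. Keeping the
  partial products in the numerator makes the identity valid even where some factor vanishes.
\<close>

lemma stirling_expansion:
  fixes V :: "nat \<Rightarrow> nat \<Rightarrow> 'a::ring_1"
  assumes step: "\<And>k j. V k (Suc j) = V (Suc k) j - of_int (\<eta> * int k * (N + \<eta> * int (k + j))) * V k j"
  assumes "i \<le> m"
  shows "V 0 m = (\<Sum>k\<le>i. of_int (int (Stirling i k) * (- \<eta>) ^ (i - k)
      * (\<Prod>r\<in>{k + m - i..<m}. N + \<eta> * int r)) * V k (m - i))"
  using assms(2)
proof (induction i)
  case (Suc i)
  define j where "j = m - Suc i"
  have mi: "m - i = Suc j" and m: "m = Suc (i + j)"
    using Suc.prems by (auto simp: j_def)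
  \<comment> \<open>The expansion coefficients obey the recursion of the Stirling numbers, weighted by the normalizing products.\<close>
  define A where "A i k = int (Stirling i k) * (- \<eta>) ^ (i - k)
      * (\<Prod>r\<in>{k + m - i..<m}. N + \<eta> * int r)" for i k
  have zero: "A (Suc i) 0 = 0" "A i (Suc i) = 0"
    by (simp_all add: A_def)
  have A: "A (Suc i) (Suc k) = A i k - \<eta> * int (Suc k) * (N + \<eta> * int (Suc k + j)) * A i (Suc k)"
    if "k \<le> i" for k
  proof (cases "k = i")
    case True
    then show ?thesis by (simp add: A_def)
  next
    case False
    with that have "Suc k \<le> i" by simp
    then have pow: "i - k = Suc (i - Suc k)" by simp
    have ivl: "{Suc k + j..<m} = insert (Suc k + j) {Suc (Suc k + j)..<m}"
      using \<open>Suc k \<le> i\<close> m by auto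
    have "A i k = int (Stirling i k) * (- \<eta>) ^ (i - k) * (\<Prod>r\<in>{Suc k + j..<m}. N + \<eta> * int r)"
      using m by (simp add: A_def)
    moreover have "A (Suc i) (Suc k) = (int (Stirling i k) + int (Suc k) * int (Stirling i (Suc k)))
        * (- \<eta>) ^ (i - k) * (\<Prod>r\<in>{Suc k + j..<m}. N + \<eta> * int r)"
      using m by (simp add: A_def algebra_simps)
    moreover have "A i (Suc k) = int (Stirling i (Suc k)) * (- \<eta>) ^ (i - Suc k)
        * (\<Prod>r\<in>{Suc (Suc k + j)..<m}. N + \<eta> * int r)"
      using m by (simp add: A_def)
    moreover have "(\<Prod>r\<in>{Suc k + j..<m}. N + \<eta> * int r)
        = (N + \<eta> * int (Suc k + j)) * (\<Prod>r\<in>{Suc (Suc k + j)..<m}. N + \<eta> * int r)"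
      unfolding ivl by (subst prod.insert) simp_all
    ultimately show ?thesis
      by (simp only: pow power_Suc) (simp only: algebra_simps)
  qed
  define c where "c k = \<eta> * int k * (N + \<eta> * int (k + j))" for k
  have distr: "of_int a * (x - of_int c * y) = of_int a * x - of_int (a * c) * y"
    for a c :: int and x y :: 'a
    by (simp add: right_diff_distrib mult.assoc)
  have "V 0 m = (\<Sum>k\<le>i. of_int (A i k) * V k (Suc j))"
    using Suc by (simp add: A_def mi)
  also have "\<dots> = (\<Sum>k\<le>i. of_int (A i k) * V (Suc k) j) - (\<Sum>k\<le>i. of_int (A i k * c k) * V k j)"
    unfolding sum_subtractf[symmetric]
    by (intro sum.cong refl) (simp only: step c_def distr)
  also have "(\<Sum>k\<le>i. of_int (A i k * c k) * V k j) = (\<Sum>k\<le>Suc i. of_int (A i k * c k) * V k j)"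
    by (simp add: zero)
  also have "\<dots> = (\<Sum>k\<le>i. of_int (A i (Suc k) * c (Suc k)) * V (Suc k) j)"
    by (subst sum.atMost_Suc_shift) (simp add: c_def)
  also have "(\<Sum>k\<le>i. of_int (A i k) * V (Suc k) j) - \<dots>
      = (\<Sum>k\<le>i. of_int (A (Suc i) (Suc k)) * V (Suc k) j)"
    unfolding sum_subtractf[symmetric]
    by (intro sum.cong refl) (simp add: A c_def left_diff_distrib mult.commute[of "A i (Suc _)"] del: of_int_mult)
  also have "\<dots> = (\<Sum>k\<le>Suc i. of_int (A (Suc i) k) * V k j)"
    by (subst sum.atMost_Suc_shift) (simp add: zero)
  finally show ?case by (simp add: A_def j_def)
qed simp

text \<open>
  The same principle for equal shifts: up to the same normalization \<open>U j i\<close> behaves like \<open>(x + u)\<^sup>j x\<^sup>i\<close>,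
  which expands by the binomial theorem.
\<close>

lemma binomial_expansion:
  fixes U :: "nat \<Rightarrow> nat \<Rightarrow> 'a::comm_ring_1"
  assumes step: "\<And>j i. U (Suc j) i = U j (Suc i) + u * of_int (N + \<eta> * int (j + i)) * U j i"
  shows "U j i = (\<Sum>k\<le>j. of_nat (j choose k) * u ^ (j - k)
      * of_int (\<Prod>r\<in>{i + k..<i + j}. N + \<eta> * int r) * U 0 (i + k))"
proof (induction j arbitrary: i)
  case (Suc j)
  \<comment> \<open>The summands of both instances of the induction hypothesis, so that Pascal's rule applies.\<close>
  define t where "t k = u ^ (Suc j - k) * of_int (\<Prod>r\<in>{i + k..<i + Suc j}. N + \<eta> * int r) * U 0 (i + k)"
    for k
  have "U j (Suc i) = (\<Sum>k\<le>j. of_nat (j choose k) * t (Suc k))"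
    by (subst Suc) (simp add: t_def mult.assoc)
  moreover have "u * of_int (N + \<eta> * int (j + i)) * U j i = (\<Sum>k\<le>j. of_nat (j choose k) * t k)"
    by (subst Suc, unfold sum_distrib_left, intro sum.cong refl)
      (auto simp: t_def Suc_diff_le algebra_simps)
  moreover have "(\<Sum>k\<le>j. of_nat (j choose k) * t k) = (\<Sum>k\<le>Suc j. of_nat (j choose k) * t k)"
    by (simp add: binomial_eq_0)
  moreover have "\<dots> = t 0 + (\<Sum>k\<le>j. of_nat (j choose Suc k) * t (Suc k))"
    by (subst sum.atMost_Suc_shift) simp
  moreover have "(\<Sum>k\<le>Suc j. of_nat (Suc j choose k) * t k)
      = t 0 + ((\<Sum>k\<le>j. of_nat (j choose Suc k) * t (Suc k)) + (\<Sum>k\<le>j. of_nat (j choose k) * t (Suc k)))"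
    unfolding sum.distrib[symmetric]
    by (subst sum.atMost_Suc_shift) (simp add: distrib_right add.commute)
  ultimately have "U (Suc j) i = (\<Sum>k\<le>Suc j. of_nat (Suc j choose k) * t k)"
    by (simp only: step add.commute add.left_commute)
  then show ?case by (simp only: t_def mult.assoc)
qed simp

text \<open>
  The step that produces the Stirling numbers: a trace without shifts is a combination of traces with
  the shifts \<open>0, \<eta>, 2\<eta>, ...\<close>.
\<close>

lemma shifted_trace_unshifted:
  fixes X :: "'n::finite \<Rightarrow> 'n \<Rightarrow> 'a::ring_1"
  assumes \<eta>: "\<eta> * \<eta> = 1"
  shows "shifted_trace \<eta> X (replicate m 0) = (\<Sum>k\<le>m. of_int (int (Stirling m k) * (- \<eta>) ^ (m - k)
      * (\<Prod>r\<in>{k..<m}. int CARD('n) + \<eta> * int r))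
      * shifted_trace \<eta> X (map (\<lambda>r. of_int (\<eta> * int r)) [0..<k]))"
proof -
  define V where "V k j = shifted_trace \<eta> X (map (\<lambda>r. of_int (\<eta> * int r)) [0..<k] @ replicate j 0)"
    for k j
  have "V k (Suc j) = V (Suc k) j - of_int (\<eta> * int k * (int CARD('n) + \<eta> * int (k + j))) * V k j" for k j
    using shifted_trace_shift[OF \<eta>, where d = "of_int (\<eta> * int k)" and X = X and c = 0
        and ?cs1.0 = "map (\<lambda>r. of_int (\<eta> * int r)) [0..<k]" and ?cs2.0 = "replicate j 0",
        OF mult_of_int_commute]
    by (simp add: V_def del: of_int_mult of_int_add flip: of_int_mult)
  from stirling_expansion[of V, OF this, of m m] show ?thesis
    by (simp add: V_def)
qed

section \<open>Centrality of the unshifted traces\<close>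

text \<open>
  The action of a matrix unit of \<open>gl_N\<close> on the coefficients of a tensor: each occurrence of the letter
  \<open>a\<close> is replaced by \<open>b\<close> in turn.
\<close>

primrec subst_sum :: "'n \<Rightarrow> 'n \<Rightarrow> ('n list \<Rightarrow> int) \<Rightarrow> 'n list \<Rightarrow> int" where
  "subst_sum a b \<phi> [] = 0"
| "subst_sum a b \<phi> (x # g) =
    (if x = a then \<phi> (b # g) else 0) + subst_sum a b (\<lambda>h. \<phi> (x # h)) g"

lemma subst_sum_lin:
  "subst_sum a b (\<lambda>h. c * \<phi> h + d * \<psi> h) g = c * subst_sum a b \<phi> g + d * subst_sum a b \<psi> g"
  by (induction g arbitrary: \<phi> \<psi>) (simp_all add: algebra_simps)

lemma subst_sum_add:
  "subst_sum a b (\<lambda>h. \<phi> h + \<psi> h) g = subst_sum a b \<phi> g + subst_sum a b \<psi> g"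
  using subst_sum_lin[of a b 1 \<phi> 1 \<psi>] by simp

lemma subst_sum_scale: "subst_sum a b (\<lambda>h. c * \<phi> h) g = c * subst_sum a b \<phi> g"
  using subst_sum_lin[of a b c \<phi> 0 \<phi>] by simp

lemma subst_sum_if:
  "subst_sum a b (\<lambda>h. if P then \<phi> h else 0) g = (if P then subst_sum a b \<phi> g else 0)"
  using subst_sum_scale[of a b 0 \<phi> g] by simp

text \<open>
  The commutator of the action of a matrix unit with an annihilation operator is an annihilation
  operator; this is the infinitesimal form of the equivariance of contraction.
\<close>

lemma subst_sum_contract:
  "subst_sum b a (contract \<eta> x \<phi>) g
    = contract \<eta> x (subst_sum b a \<phi>) g + (if x = a then contract \<eta> b \<phi> g else 0)"
proof (induction g arbitrary: \<phi>)
  case (Cons j g)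
  show ?case
    using Cons[of "\<lambda>h. \<phi> (j # h)"]
    by (simp add: subst_sum_add subst_sum_scale subst_sum_if contract_add contract_scale contract_if
        distrib_left)
qed simp

lemma subst_sum_contract_exchange:
  "subst_sum a b (\<lambda>h. contract \<eta> x (\<psi> h) g) f = contract \<eta> x (\<lambda>k. subst_sum a b (\<lambda>h. \<psi> h k) f) g"
proof (induction f arbitrary: \<psi>)
  case (Cons y f)
  show ?case by (simp add: contract_add contract_if Cons)
qed simp

text \<open>
  The (anti)symmetrizer commutes with the action of \<open>gl_N\<close> on tensors; acting on the rows of its matrix
  by a matrix unit is acting on the columns by the transposed one.
\<close>

lemma kron_invariant: "subst_sum a b (\<lambda>f. kron \<eta> f g) f = subst_sum b a (kron \<eta> f) g"
proof (induction f arbitrary: g)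
  case Nil
  have "subst_sum b a (\<lambda>h. 0) g = 0" for g
    using subst_sum_scale[of b a 0] by simp
  then have "subst_sum b a (kron \<eta> []) g = 0" by (cases g) auto
  then show ?case by simp
next
  case (Cons x f)
  have "(\<lambda>k. subst_sum a b (\<lambda>h. kron \<eta> h k) f) = subst_sum b a (kron \<eta> f)"
    using Cons by (simp add: fun_eq_iff)
  then have "subst_sum a b (\<lambda>h. contract \<eta> x (kron \<eta> h) g) f = contract \<eta> x (subst_sum b a (kron \<eta> f)) g"
    by (simp only: subst_sum_contract_exchange)
  then show ?case
    by (simp add: subst_sum_contract)
qed

text \<open>
  The relations of \<open>gl_N\<close> in an arbitrary ring, so that the computations up to the Capelli elements can
  be done without a reference to the enveloping algebra.
\<close>

definition gl_relations :: "('n \<Rightarrow> 'n \<Rightarrow> 'a::ring_1) \<Rightarrow> bool" where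
  "gl_relations X \<longleftrightarrow> (\<forall>i j k l. X i j * X k l - X k l * X i j
    = (if k = j then X i l else 0) - (if i = l then X k j else 0))"

text \<open>
  The commutator with a generator is a derivation, and on a single entry it changes the row or the
  column index. Reindexing the sum transfers this change from the words to their coefficients.
\<close>

lemma commutator_word_sum:
  fixes X :: "'n::finite \<Rightarrow> 'n \<Rightarrow> 'a::ring_1"
  assumes X: "gl_relations X"
  shows "(\<Sum>f\<in>tuples m. \<Sum>g\<in>tuples m. of_int (c f g)
        * (X a b * word X (replicate m 0) f g - word X (replicate m 0) f g * X a b))
    = (\<Sum>f\<in>tuples m. \<Sum>g\<in>tuples m. of_int (subst_sum a b (\<lambda>f. c f g) f - subst_sum b a (c f) g)
        * word X (replicate m 0) f g)"
proof (induction m arbitrary: c)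
  case (Suc m)
  let ?W = "word X (replicate m 0)"
  have comm: "X a b * (X i j * w) - X i j * w * X a b
      = ((if i = b then X a j else 0) - (if a = j then X i b else 0)) * w
        + X i j * (X a b * w - w * X a b)" for i j w
  proof -
    have "X a b * X i j - X i j * X a b = (if i = b then X a j else 0) - (if a = j then X i b else 0)"
      using X by (simp add: gl_relations_def)
    then have "X a b * X i j = X i j * X a b + ((if i = b then X a j else 0) - (if a = j then X i b else 0))"
      by (simp only: diff_eq_eq add.commute)
    then have "X a b * (X i j * w)
        = X i j * (X a b * w) + ((if i = b then X a j else 0) - (if a = j then X i b else 0)) * w"
      by (simp only: mult.assoc[symmetric] distrib_right)
    then show ?thesis
      by (simp only: mult.assoc right_diff_distrib) simp
  qed
  have left: "(\<Sum>i\<in>UNIV. \<Sum>j\<in>UNIV. of_int (c (i # f) (j # g))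
        * (((if i = b then X a j else 0) - (if a = j then X i b else 0)) * ?W f g))
    = (\<Sum>i\<in>UNIV. \<Sum>j\<in>UNIV. of_int ((if i = a then c (b # f) (j # g) else 0)
        - (if j = b then c (i # f) (a # g) else 0)) * (X i j * ?W f g))" for f g
  proof -
    have "(\<Sum>i\<in>UNIV. \<Sum>j\<in>UNIV. of_int (c (i # f) (j # g))
        * (((if i = b then X a j else 0) - (if a = j then X i b else 0)) * ?W f g))
      = (\<Sum>i\<in>UNIV. \<Sum>j\<in>UNIV. if i = b then of_int (c (i # f) (j # g)) * (X a j * ?W f g) else 0)
        - (\<Sum>i\<in>UNIV. \<Sum>j\<in>UNIV. if a = j then of_int (c (i # f) (j # g)) * (X i b * ?W f g) else 0)"
      unfolding sum_subtractf[symmetric]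
      by (intro sum.cong refl) (simp add: left_diff_distrib right_diff_distrib)
    also have "(\<Sum>i\<in>UNIV. \<Sum>j\<in>UNIV. if i = b then of_int (c (i # f) (j # g)) * (X a j * ?W f g) else 0)
      = (\<Sum>j\<in>UNIV. of_int (c (b # f) (j # g)) * (X a j * ?W f g))"
      by (subst sum.swap) simp
    also have "\<dots> = (\<Sum>i\<in>UNIV. \<Sum>j\<in>UNIV. if i = a then of_int (c (b # f) (j # g)) * (X i j * ?W f g) else 0)"
      by (subst sum.swap) simp
    also have "(\<Sum>i\<in>UNIV. \<Sum>j\<in>UNIV. if a = j then of_int (c (i # f) (j # g)) * (X i b * ?W f g) else 0)
      = (\<Sum>i\<in>UNIV. \<Sum>j\<in>UNIV. if j = b then of_int (c (i # f) (a # g)) * (X i j * ?W f g) else 0)"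
      by simp
    finally have "(\<Sum>i\<in>UNIV. \<Sum>j\<in>UNIV. of_int (c (i # f) (j # g))
        * (((if i = b then X a j else 0) - (if a = j then X i b else 0)) * ?W f g))
      = (\<Sum>i\<in>UNIV. \<Sum>j\<in>UNIV. (if i = a then of_int (c (b # f) (j # g)) * (X i j * ?W f g) else 0)
        - (if j = b then of_int (c (i # f) (a # g)) * (X i j * ?W f g) else 0))"
      by (simp only: sum_subtractf)
    moreover have "of_int ((if i = a then x else 0) - (if j = b then y else 0)) * w
        = (if i = a then of_int x * w else 0) - (if j = b then of_int y * w else 0)"
      for i j x y and w :: 'a
      by (simp add: left_diff_distrib)
    ultimately show ?thesis
      by (simp only:)
  qed
  have right: "(\<Sum>f\<in>tuples m. \<Sum>g\<in>tuples m. of_int (c (i # f) (j # g))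
        * (X i j * (X a b * ?W f g - ?W f g * X a b)))
    = (\<Sum>f\<in>tuples m. \<Sum>g\<in>tuples m.
        of_int (subst_sum a b (\<lambda>f. c (i # f) (j # g)) f - subst_sum b a (\<lambda>g. c (i # f) (j # g)) g)
          * (X i j * ?W f g))" for i j
  proof -
    have pull: "X i j * (of_int z * w) = of_int z * (X i j * w)" for z w
      by (metis mult.assoc mult_of_int_commute)
    show ?thesis
      using arg_cong[OF Suc[of "\<lambda>f g. c (i # f) (j # g)"], of "(*) (X i j)"]
      by (simp only: sum_distrib_left pull)
  qed
  have swap: "(\<Sum>i\<in>UNIV. \<Sum>j\<in>UNIV. \<Sum>f\<in>tuples m. \<Sum>g\<in>tuples m. F i j f g)
      = (\<Sum>f\<in>tuples m. \<Sum>g\<in>tuples m. \<Sum>i\<in>UNIV. \<Sum>j\<in>UNIV. F i j f g)"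
    for F :: "'n \<Rightarrow> 'n \<Rightarrow> 'n list \<Rightarrow> 'n list \<Rightarrow> 'a"
  proof -
    have "(\<Sum>(i, j)\<in>UNIV \<times> UNIV. \<Sum>(f, g)\<in>tuples m \<times> tuples m. F i j f g)
        = (\<Sum>(f, g)\<in>tuples m \<times> tuples m. \<Sum>(i, j)\<in>UNIV \<times> UNIV. F i j f g)"
      unfolding case_prod_unfold by (rule sum.swap)
    then show ?thesis
      unfolding sum.cartesian_product[symmetric] .
  qed
  show ?case
    unfolding sum_tuples_Suc2 replicate_Suc word_Cons if_cancel add_0_right comm distrib_left sum.distrib
    unfolding right swap left
    unfolding swap[symmetric] sum.distrib[symmetric]
    by (intro sum.cong refl) (simp only: distrib_right[symmetric] of_int_add[symmetric] subst_sum.simps,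
        intro arg_cong2[of _ _ _ _ "(*)"] arg_cong[of _ _ of_int] refl, simp only: algebra_simps)
qed simp

text \<open>
  Centrality: commuting with a generator acts on the coefficients as the difference of the two sides of
  \<open>kron_invariant\<close>.
\<close>

lemma shifted_trace_commute:
  assumes "gl_relations X"
  shows "X a b * shifted_trace \<eta> X (replicate m 0) = shifted_trace \<eta> X (replicate m 0) * X a b"
proof -
  have pull: "X a b * (of_int z * w) = of_int z * (X a b * w)" for z w
    by (metis mult.assoc mult_of_int_commute)
  have "X a b * shifted_trace \<eta> X (replicate m 0) - shifted_trace \<eta> X (replicate m 0) * X a b
      = (\<Sum>f\<in>tuples m. \<Sum>g\<in>tuples m. of_int (kron \<eta> f g)
        * (X a b * word X (replicate m 0) f g - word X (replicate m 0) f g * X a b))"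
    by (simp add: shifted_trace_def sum_distrib_left sum_distrib_right pull mult.assoc
        sum_subtractf right_diff_distrib)
  also have "\<dots> = 0"
    by (simp add: commutator_word_sum[OF assms] kron_invariant)
  finally show ?thesis by simp
qed

section \<open>Capelli elements\<close>

text \<open>
  The heart of the Capelli phenomenon. Against a coefficient that is (anti)symmetric in the row indices,
  the columns \<open>p\<close> and \<open>q\<close> of a quadratic expression can be exchanged, at the cost of a factor \<open>\<eta>\<close>,
  once the second factor is shifted by \<open>\<eta>\<close> relative to the first one: the shift compensates for the
  linear terms of the commutator.
\<close>

lemma capelli_exchange:
  fixes X :: "'n::finite \<Rightarrow> 'n \<Rightarrow> 'a::ring_1"
  assumes \<eta>: "\<eta> * \<eta> = 1" and X: "gl_relations X" and \<alpha>: "\<And>a b. \<alpha> a b = \<eta> * \<alpha> b a"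
  shows "(\<Sum>a\<in>UNIV. \<Sum>b\<in>UNIV. of_int (\<alpha> a b)
        * ((X a p + (if a = p then of_int c else 0)) * (X b q + (if b = q then of_int (c + \<eta>) else 0))))
    = of_int \<eta> * (\<Sum>a\<in>UNIV. \<Sum>b\<in>UNIV. of_int (\<alpha> a b)
        * ((X a q + (if a = q then of_int c else 0)) * (X b p + (if b = p then of_int (c + \<eta>) else 0))))"
    (is "?L = of_int \<eta> * ?R")
proof -
  let ?d = "\<lambda>a p. if a = p then 1 else 0 :: int"
  have delta: "(if a = p then of_int z else 0) = of_int z * of_int (?d a p)" for a p z
    by simp
  have pull: "X i j * (of_int z * w) = of_int z * (X i j * w)" for z w i j
    by (metis mult.assoc mult_of_int_commute)
  have pull': "X i j * of_int z = of_int z * X i j" for z i j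
    by (metis mult_of_int_commute)
  have "of_int \<eta> * ?R = (\<Sum>b\<in>UNIV. \<Sum>a\<in>UNIV. of_int (\<alpha> a b)
        * ((X b q + (if b = q then of_int c else 0)) * (X a p + (if a = p then of_int (c + \<eta>) else 0))))"
    unfolding sum_distrib_left
    by (intro sum.cong refl) (subst \<alpha>, simp add: mult.assoc)
  also have "\<dots> = (\<Sum>a\<in>UNIV. \<Sum>b\<in>UNIV. of_int (\<alpha> a b)
        * ((X b q + (if b = q then of_int c else 0)) * (X a p + (if a = p then of_int (c + \<eta>) else 0))))"
    by (rule sum.swap)
  finally have R: "of_int \<eta> * ?R = \<dots>" .
  have diff: "of_int (\<alpha> a b)
        * ((X a p + (if a = p then of_int c else 0)) * (X b q + (if b = q then of_int (c + \<eta>) else 0)))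
      - of_int (\<alpha> a b)
        * ((X b q + (if b = q then of_int c else 0)) * (X a p + (if a = p then of_int (c + \<eta>) else 0)))
      = (if b = p then of_int (\<alpha> a p) * X a q else 0) - (if a = q then of_int (\<alpha> q b) * X b p else 0)
        + (if b = q then of_int (\<eta> * \<alpha> a q) * X a p else 0) - (if a = p then of_int (\<eta> * \<alpha> p b) * X b q else 0)"
    for a b
  proof -
    have comm: "X a p * X b q = X b q * X a p + ((if b = p then X a q else 0) - (if a = q then X b p else 0))"
      using X[unfolded gl_relations_def, rule_format, of a p b q] by (simp only: diff_eq_eq add.commute)
    have product: "(X i j + of_int s) * (X k l + of_int t)
        = X i j * X k l + of_int t * X i j + of_int s * X k l + of_int (s * t)" for i j k l s t
      by (simp add: distrib_left distrib_right pull' add.assoc)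
    \<comment> \<open>Only the terms that are linear in the relative shift remain in the difference.\<close>
    have cancel: "x * (u + d + of_int (r + e) * v + of_int s * w + z)
          - x * (u + of_int (s + e') * w + of_int r * v + z)
        = x * d + (x * (of_int e * v) - x * (of_int e' * w))" for x u d v w z :: 'a and r e e' s
      by (simp add: distrib_left distrib_right)
    define S T where "S = (if a = p then c else 0)" and "T = (if b = q then c else 0)"
    define A B where "A = (if a = p then \<eta> else 0)" and "B = (if b = q then \<eta> else 0)"
    have ifs: "(if a = p then of_int c else 0) = (of_int S :: 'a)"
      "(if a = p then of_int (c + \<eta>) else 0) = (of_int (S + A) :: 'a)"
      "(if b = q then of_int c else 0) = (of_int T :: 'a)"
      "(if b = q then of_int (c + \<eta>) else 0) = (of_int (T + B) :: 'a)"
      by (simp_all add: S_def T_def A_def B_def)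
    have const: "S * (T + B) = T * (S + A)"
      by (auto simp: S_def T_def A_def B_def)
    show ?thesis
      unfolding ifs product comm const cancel
      by (simp add: A_def B_def mult.assoc mult.commute[of \<eta>] right_diff_distrib)
  qed
  \<comment> \<open>By the symmetry of the coefficients the four linear terms cancel in pairs.\<close>
  have flip: "of_int (\<eta> * \<alpha> a q) * X a p = of_int (\<alpha> q a) * X a p" for a p q
    using \<alpha>[of q a] by simp
  have "?L - of_int \<eta> * ?R = (\<Sum>a\<in>UNIV. of_int (\<alpha> a p) * X a q) - (\<Sum>b\<in>UNIV. of_int (\<alpha> q b) * X b p)
      + (\<Sum>a\<in>UNIV. of_int (\<eta> * \<alpha> a q) * X a p) - (\<Sum>b\<in>UNIV. of_int (\<eta> * \<alpha> p b) * X b q)"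
  proof -
    have swap: "(\<Sum>a\<in>UNIV. \<Sum>b\<in>UNIV. if a = q then F b else 0) = (\<Sum>b\<in>UNIV. F b)"
      for F :: "'n \<Rightarrow> 'a" and q :: 'n
      by (subst sum.swap) simp
    show ?thesis
      unfolding R sum_subtractf[symmetric] diff
      unfolding sum_subtractf sum.distrib swap by simp
  qed
  also have "\<dots> = 0"
  proof -
    have "of_int (\<alpha> a p) * X a q = of_int (\<eta> * \<alpha> p a) * X a q" for a
      by (subst \<alpha>) simp
    then show ?thesis by (simp only: flip) simp
  qed
  finally show ?thesis by simp
qed

text \<open>
  Shifts by \<open>0, -1, -2, ...\<close> for the antisymmetrizer and by \<open>0, 1, 2, ...\<close> for the symmetrizer.
\<close>

definition capelli_shifts :: "int \<Rightarrow> nat \<Rightarrow> 'a::ring_1 list" where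
  "capelli_shifts \<eta> m = map (\<lambda>r. of_int (\<eta> * int r)) [0..<m]"

text \<open>
  For \<open>\<eta> = -1\<close> and \<open>h = g\<close> this is the column determinant
  \<open>\<Sum>\<^sub>\<sigma> sgn \<sigma> \<Prod>\<^sub>r (X - r)\<^bsub>g(\<sigma>(r)), g(r)\<^esub>\<close> of the classical Capelli identity; for \<open>\<eta> = 1\<close> it is the analogous permanent. Separate
  row and column lists allow for exchanges on one side only.
\<close>

definition capelli :: "int \<Rightarrow> ('n::finite \<Rightarrow> 'n \<Rightarrow> 'a::ring_1) \<Rightarrow> 'n list \<Rightarrow> 'n list \<Rightarrow> 'a" where
  "capelli \<eta> X h g = (\<Sum>f\<in>tuples (length g). of_int (kron \<eta> f h)
    * word X (capelli_shifts \<eta> (length g)) f g)"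

lemma swap_covariant_capelli_left:
  fixes X :: "'n::finite \<Rightarrow> 'n \<Rightarrow> 'a::ring_1"
  assumes "\<eta> * \<eta> = 1"
  shows "swap_covariant \<eta> (\<lambda>h. capelli \<eta> X h g)"
  unfolding swap_covariant_def
proof (intro allI)
  fix h k :: "'n list" and a b
  have "kron \<eta> f (h @ a # b # k) = \<eta> * kron \<eta> f (h @ b # a # k)" for f
    using swap_covariantD[OF swap_covariant_kron_right[OF assms], of f h a b k] by simp
  then show "capelli \<eta> X (h @ a # b # k) g = of_int \<eta> * capelli \<eta> X (h @ b # a # k) g"
    by (simp add: capelli_def sum_distrib_left mult.assoc)
qed

text \<open>
  \<open>capelli_exchange\<close> applied to two neighbouring factors; what stands to the left and to the right of
  them is the same on both sides.
\<close>

lemma swap_covariant_capelli_right: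
  fixes X :: "'n::finite \<Rightarrow> 'n \<Rightarrow> 'a::ring_1"
  assumes \<eta>: "\<eta> * \<eta> = 1" and X: "gl_relations X"
  shows "swap_covariant \<eta> (capelli \<eta> X h)"
  unfolding swap_covariant_def
proof (intro allI)
  fix g1 g2 :: "'n list" and p q
  define m n where "m = length g1" and "n = length g2"
  define cs1 cs2 where "cs1 = (capelli_shifts \<eta> m :: 'a list)"
    and "cs2 = (map (\<lambda>r. of_int (\<eta> * int r)) [Suc (Suc m)..<Suc (Suc (m + n))] :: 'a list)"
  define c where "c = \<eta> * int m"
  have "[0..<Suc (Suc (m + n))] = [0..<m] @ m # Suc m # [Suc (Suc m)..<Suc (Suc (m + n))]"
    using upt_add_eq_append[of 0 m "Suc (Suc n)"] by (simp add: upt_conv_Cons del: upt_Suc)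
  then have shifts: "capelli_shifts \<eta> (Suc (Suc (m + n))) = cs1 @ of_int c # of_int (c + \<eta>) # cs2"
    by (simp add: capelli_shifts_def cs1_def cs2_def c_def algebra_simps)
  have expand: "capelli \<eta> X h (g1 @ p # q # g2)
      = (\<Sum>f1\<in>tuples m. \<Sum>f2\<in>tuples n. word X cs1 f1 g1 *
          (\<Sum>a\<in>UNIV. \<Sum>b\<in>UNIV. of_int (kron \<eta> (f1 @ a # b # f2) h)
            * ((X a p + (if a = p then of_int c else 0)) * (X b q + (if b = q then of_int (c + \<eta>) else 0))))
          * word X cs2 f2 g2)" for p q
  proof -
    have pull: "w * (of_int z * v) = of_int z * (w * v)" for z :: int and w v :: 'a
      by (metis mult.assoc mult_of_int_commute)
    have len: "length (g1 @ p # q # g2) = Suc (Suc (m + n))"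
      by (simp add: m_def n_def)
    have split: "(\<Sum>f\<in>tuples (Suc (Suc (m + n))). F f)
        = (\<Sum>f1\<in>tuples m. \<Sum>f2\<in>tuples n. \<Sum>a\<in>UNIV. \<Sum>b\<in>UNIV. F (f1 @ a # b # f2))"
      for F :: "'n list \<Rightarrow> 'a"
    proof -
      have "(\<Sum>b\<in>UNIV. \<Sum>f2\<in>tuples n. \<Sum>a\<in>UNIV. F (f1 @ a # b # f2))
          = (\<Sum>f2\<in>tuples n. \<Sum>a\<in>UNIV. \<Sum>b\<in>UNIV. F (f1 @ a # b # f2))" for f1
        by (subst sum.swap) (intro sum.cong refl sum.swap)
      then show ?thesis
        using sum_tuples_insert[of F m "Suc n"] by (simp add: sum_tuples_Suc)
    qed
    show ?thesis
      unfolding capelli_def len split shifts sum_distrib_left sum_distrib_right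
      by (intro sum.cong refl)
        (simp add: word_append tuples_def m_def cs1_def capelli_shifts_def mult.assoc pull)
  qed
  show "capelli \<eta> X h (g1 @ p # q # g2) = of_int \<eta> * capelli \<eta> X h (g1 @ q # p # g2)"
    unfolding expand sum_distrib_left[of "of_int \<eta>"]
  proof (intro sum.cong refl)
    fix f1 f2
    have sym: "kron \<eta> (f1 @ a # b # f2) h = \<eta> * kron \<eta> (f1 @ b # a # f2) h" for a b
      using swap_covariantD[OF swap_covariant_kron_left[OF \<eta>, of h], of f1 a b f2] by simp
    have pull: "w * (of_int \<eta> * v) * w' = of_int \<eta> * (w * v * w')" for w v w' :: 'a
      by (metis mult.assoc mult_of_int_commute)
    show "word X cs1 f1 g1 *
          (\<Sum>a\<in>UNIV. \<Sum>b\<in>UNIV. of_int (kron \<eta> (f1 @ a # b # f2) h)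
            * ((X a p + (if a = p then of_int c else 0)) * (X b q + (if b = q then of_int (c + \<eta>) else 0))))
          * word X cs2 f2 g2
        = of_int \<eta> * (word X cs1 f1 g1 *
          (\<Sum>a\<in>UNIV. \<Sum>b\<in>UNIV. of_int (kron \<eta> (f1 @ a # b # f2) h)
            * ((X a q + (if a = q then of_int c else 0)) * (X b p + (if b = p then of_int (c + \<eta>) else 0))))
          * word X cs2 f2 g2)"
      unfolding capelli_exchange[where \<alpha> = "\<lambda>a b. kron \<eta> (f1 @ a # b # f2) h" and p = p and q = q,
          OF \<eta> X sym]
      by (rule pull)
  qed
qed

lemma shifted_trace_capelli:
  "shifted_trace \<eta> X (capelli_shifts \<eta> m) = (\<Sum>g\<in>tuples m. capelli \<eta> X g g)"
proof -
  have "shifted_trace \<eta> X (capelli_shifts \<eta> m) = (\<Sum>g\<in>tuples m. \<Sum>f\<in>tuples m.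
      of_int (kron \<eta> f g) * word X (capelli_shifts \<eta> m) f g)"
    unfolding shifted_trace_def by (subst sum.swap) (simp add: capelli_shifts_def)
  also have "\<dots> = (\<Sum>g\<in>tuples m. capelli \<eta> X g g)"
    by (intro sum.cong refl) (simp add: capelli_def tuples_def)
  finally show ?thesis .
qed

text \<open>
  Simultaneous exchange of two rows and the corresponding two columns gives the factor
  \<open>\<eta> * \<eta> = 1\<close>. So the Capelli elements can be evaluated on sorted lists only.
\<close>

lemma capelli_mset_eq:
  fixes X :: "'n::finite \<Rightarrow> 'n \<Rightarrow> 'a::ring_1"
  assumes \<eta>: "\<eta> * \<eta> = 1" and X: "gl_relations X" and "mset g = mset h"
  shows "capelli \<eta> X g g = capelli \<eta> X h h"
  using _ assms(3)
proof (rule swap_invariant_mset_eq)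
  fix k l :: "'n list" and a b
  have "capelli \<eta> X (k @ a # b # l) (k @ a # b # l)
      = of_int \<eta> * (of_int \<eta> * capelli \<eta> X (k @ b # a # l) (k @ b # a # l))"
    using swap_covariantD[OF swap_covariant_capelli_left[OF \<eta>, of X "k @ a # b # l"], of k a b l]
      swap_covariantD[OF swap_covariant_capelli_right[OF \<eta> X, of "k @ b # a # l"], of k a b l]
    by simp
  also have "\<dots> = capelli \<eta> X (k @ b # a # l) (k @ b # a # l)"
    by (simp add: \<eta> mult.assoc[symmetric] flip: of_int_mult)
  finally show "capelli \<eta> X (k @ a # b # l) (k @ a # b # l)
      = capelli \<eta> X (k @ b # a # l) (k @ b # a # l)" .
qed

section \<open>Counting the rearrangements of a list\<close>

lemma sum_contract_const:
  fixes g :: "'n::finite list"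
  assumes "\<And>h. Suc (length h) = length g \<Longrightarrow> \<phi> h = c"
  shows "(\<Sum>i\<in>UNIV. contract 1 i \<phi> g) = int (length g) * c"
  using assms
proof (induction g arbitrary: \<phi>)
  case (Cons j g)
  then show ?case by (simp add: sum.distrib algebra_simps)
qed simp

text \<open>
  For the symmetrizer every expansion step contributes one term for each remaining letter of \<open>g\<close>,
  whatever these letters are.
\<close>

lemma sum_kron:
  fixes g :: "'n::finite list"
  assumes "length g = m"
  shows "(\<Sum>f\<in>tuples m. kron 1 f g) = fact m"
  using assms
proof (induction m arbitrary: g)
  case (Suc m)
  have lin: "contract 1 i (\<lambda>h. \<Sum>f\<in>F. \<psi> f h) k = (\<Sum>f\<in>F. contract 1 i (\<psi> f) k)"
    if "finite F" for i k F and \<psi> :: "'n list \<Rightarrow> 'n list \<Rightarrow> int"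
    using that by (induction F rule: finite_induct) (simp_all add: contract_add)
  have "(\<Sum>f\<in>tuples (Suc m). kron 1 f g) = (\<Sum>i\<in>UNIV. contract 1 i (\<lambda>h. \<Sum>f\<in>tuples m. kron 1 f h) g)"
    by (simp add: sum_tuples_Suc lin)
  also have "\<dots> = int (length g) * fact m"
    by (rule sum_contract_const) (use Suc in auto)
  finally show ?case using Suc.prems by simp
qed auto

lemma contract_notin: "i \<notin> set g \<Longrightarrow> contract \<eta> i \<phi> g = 0"
  by (induction g arbitrary: \<phi>) auto

lemma kron_distinct: "distinct f \<Longrightarrow> kron \<eta> f f = 1"
  by (induction f) (simp_all add: contract_notin)

lemma swap_covariant_far_swap:
  assumes \<eta>: "\<eta> * \<eta> = 1" and \<phi>: "swap_covariant \<eta> \<phi>"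
  shows "\<phi> (h @ a # k @ b # g) = of_int \<eta> * \<phi> (h @ b # k @ a # g)"
proof (induction k arbitrary: h)
  case Nil
  then show ?case using swap_covariantD[OF \<phi>, of h a b g] by simp
next
  case (Cons c k)
  have "\<phi> (h @ a # c # k @ b # g) = of_int \<eta> * (of_int \<eta> * (of_int \<eta> * \<phi> (h @ b # c # k @ a # g)))"
    using swap_covariantD[OF \<phi>, of h a c "k @ b # g"] Cons[of "h @ [c]"]
      swap_covariantD[OF \<phi>, of h c b "k @ a # g"] by simp
  also have "of_int \<eta> * (of_int \<eta> * x) = x" for x :: 'b
    by (metis \<eta> mult.assoc mult_1_left of_int_1 of_int_mult)
  finally show ?case by simp
qed

lemma swap_covariant_not_distinct:
  fixes \<phi> :: "'b list \<Rightarrow> int"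
  assumes "swap_covariant (- 1) \<phi>" "\<not> distinct g"
  shows "\<phi> g = 0"
proof -
  obtain h k l a where "g = h @ [a] @ k @ [a] @ l"
    using assms(2) not_distinct_decomp by blast
  then show ?thesis
    using swap_covariant_far_swap[OF _ assms(1), of h a k a l] by simp
qed

text \<open>
  Summing over all lists instead of the sorted ones counts \<open>s\<close> once for each of its rearrangements.
  For the symmetrizer, \<open>kron\<close> is constant on the rearrangements and its values add up to \<open>m!\<close>, so that
  multiplicities drop out. For the antisymmetrizer only lists of distinct letters survive, and these
  have \<open>m!\<close> rearrangements.
\<close>

lemma kron_class_sum:
  fixes s :: "'n::finite list"
  assumes "\<eta> = 1 \<or> \<eta> = - 1"
  shows "int (card {g. mset g = mset s}) * kron \<eta> s s
    = (if \<eta> = 1 \<or> distinct s then fact (length s) else 0)"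
proof (cases "\<eta> = 1")
  case True
  have eq: "kron 1 f s = kron 1 s s" if "mset f = mset s" for f
    by (rule swap_invariant_mset_eq[OF _ that])
      (use swap_covariantD[OF swap_covariant_kron_left[of 1 s]] in simp)
  have "(\<Sum>f\<in>tuples (length s). kron 1 f s) = (\<Sum>f\<in>{g. mset g = mset s}. kron 1 f s)"
  proof (rule sum.mono_neutral_right)
    show "{g. mset g = mset s} \<subseteq> tuples (length s)"
      by (auto simp: tuples_def dest: mset_eq_length)
  qed (use kron_support in auto)
  also have "\<dots> = (\<Sum>f\<in>{g. mset g = mset s}. kron 1 s s)"
    by (intro sum.cong refl eq) simp
  also have "\<dots> = int (card {g. mset g = mset s}) * kron 1 s s"
    by simp
  finally show ?thesis using sum_kron[of s] True by simp
next
  case False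
  show ?thesis
  proof (cases "distinct s")
    case True
    have "{g. mset g = mset s} = permutations_of_set (set s)"
      using True by (auto simp: permutations_of_set_def set_eq_iff_mset_eq_distinct dest: mset_eq_setD mset_eq_imp_distinct_iff)
    then show ?thesis
      using True by (simp add: kron_distinct distinct_card)
  next
    case False
    then have "kron \<eta> s s = 0"
      using \<open>\<eta> \<noteq> 1\<close> assms swap_covariant_not_distinct[OF swap_covariant_kron_right[of "- 1" s]] by auto
    then show ?thesis using False \<open>\<eta> \<noteq> 1\<close> by simp
  qed
qed

section \<open>Constants and generators of the enveloping algebra\<close>

lemma poly_mapping_single_induct [case_names zero add]:
  fixes p :: "'b \<Rightarrow>\<^sub>0 'c::comm_monoid_add"
  assumes "P 0" and "\<And>p k c. P p \<Longrightarrow> P (p + Poly_Mapping.single k c)"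
  shows "P p"
proof (induction p rule: Poly_Mapping.update_induct)
  case (update p k c)
  have "Poly_Mapping.update k c p = p + Poly_Mapping.single k c"
    using update(1)
    by (intro poly_mapping_eqI) (auto simp: lookup_update lookup_add lookup_single when_def in_keys_iff)
  then show ?case using assms(2)[OF update(3)] by simp
qed (rule assms(1))

lemma ugl_const_mult: "ugl_const (a * b) = ugl_const a * ugl_const b"
  by transfer (simp add: mult_single ugl_rel_def commutator_ideal_zero)

lemma ugl_const_add: "ugl_const (a + b) = ugl_const a + ugl_const b"
  by transfer (simp add: single_add ugl_rel_def commutator_ideal_zero)

lemma ugl_const_0: "ugl_const 0 = 0"
  by transfer (simp add: ugl_rel_def commutator_ideal_zero)

lemma ugl_const_uminus: "ugl_const (- a) = - ugl_const a"
  by transfer (simp add: single_uminus ugl_rel_def commutator_ideal_zero)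

lemma ugl_const_of_nat: "ugl_const (of_nat n) = of_nat n"
  by (induction n) (simp_all add: ugl_const_0 ugl_const_1 ugl_const_add)

lemma ugl_const_of_int: "ugl_const (of_int z) = of_int z"
  by (cases z rule: int_cases2) (simp_all add: ugl_const_of_nat ugl_const_uminus ugl_const_add ugl_const_1)

lemma ugl_const_central: "ugl_const c * a = a * ugl_const c"
proof transfer
  fix c and a :: "'a tensor_alg"
  have "Poly_Mapping.single 0 c * a = a * Poly_Mapping.single 0 c"
    by (induction a rule: poly_mapping_single_induct)
      (simp_all add: distrib_left distrib_right mult_single mult.commute)
  then show "ugl_rel (Poly_Mapping.single 0 c * a) (a * Poly_Mapping.single 0 c)"
    by (simp add: ugl_rel_def commutator_ideal_zero)
qed

lemma gl_relations_ugl_gen: "gl_relations ugl_gen"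
  by (simp add: gl_relations_def ugl_gen_commutator)

text \<open>
  Constants and generators generate the enveloping algebra as a ring. This turns centrality into
  commutation with the generators.
\<close>

lemma ugl_induct [case_names const gen add mult]:
  assumes const: "\<And>c. P (ugl_const c)" and gen: "\<And>i j. P (ugl_gen i j)"
    and add: "\<And>a b. P a \<Longrightarrow> P b \<Longrightarrow> P (a + b)" and mult: "\<And>a b. P a \<Longrightarrow> P b \<Longrightarrow> P (a * b)"
  shows "P a"
proof -
  have monomial: "P (abs_ugl (Poly_Mapping.single (Letters xs) c))" for xs :: "('a \<times> 'a) list" and c
  proof (induction xs)
    case Nil
    show ?case using const[of c] by (simp add: ugl_const.abs_eq zero_free_monoid_def)
  next
    case (Cons x xs)
    obtain i j where x: "x = (i, j)" by (cases x)
    have "abs_ugl (Poly_Mapping.single (Letters (x # xs)) c)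
        = ugl_gen i j * abs_ugl (Poly_Mapping.single (Letters xs) c)"
      by (simp add: ugl_gen.abs_eq times_ugl.abs_eq tensor_gen_def mult_single x)
    then show ?case using mult[OF gen Cons] by simp
  qed
  have "\<exists>p. a = abs_ugl p" by (induction a rule: ugl.abs_induct) blast
  then obtain p where "a = abs_ugl p" ..
  moreover have "P (abs_ugl p)"
  proof (induction p rule: poly_mapping_single_induct)
    case zero
    show ?case using const[of 0] by (simp add: ugl_const_0 zero_ugl.abs_eq)
  next
    case (add p k c)
    obtain xs where "k = Letters xs" by (cases k)
    then show ?case
      using assms(3)[OF add monomial[of xs c]] by (simp add: plus_ugl.abs_eq)
  qed
  ultimately show ?thesis by simp
qed

section \<open>Action on the highest weight vector\<close>

context gl_module
begin

lemma act_of_int: "act (of_int z) v = scale (of_int z) v"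
  using act_const[of "of_int z" v] by (simp add: ugl_const_of_int)

lemma act_scale: "act a (scale c v) = scale c (act a v)"
  by (metis act_const act_mult ugl_const_central)

lemma act_zero_right [simp]: "act a 0 = 0"
  using act_add_right[of a 0 0] by simp

lemma act_zero_left [simp]: "act 0 v = 0"
  using act_add_left[of 0 0 v] by simp

lemma act_sum: "act (\<Sum>i\<in>A. F i) v = (\<Sum>i\<in>A. act (F i) v)"
  by (induction A rule: infinite_finite_induct) (simp_all add: act_add_left)

end

context irreducible_highest_weight_module
begin

text \<open>
  The vectors on which a central element acts by \<open>\<mu>\<close> form a submodule. It contains the generating
  vector \<open>\<xi>\<close>, so it is everything.
\<close>

lemma act_central_scalar:
  assumes comm: "\<And>i j. ugl_gen i j * z = z * ugl_gen i j" and \<xi>: "act z \<xi> = scale \<mu> \<xi>"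
  shows "act z v = scale \<mu> v"
proof -
  have central: "a * z = z * a" for a
  proof (induction a rule: ugl_induct)
    case (const c)
    show ?case by (rule ugl_const_central)
  next
    case (mult a b)
    then show ?case by (metis mult.assoc)
  qed (simp_all add: comm distrib_left distrib_right)
  have "submodule {v. act z v = scale \<mu> v}"
    unfolding submodule_def
  proof (intro conjI allI ballI)
    show "subspace {v. act z v = scale \<mu> v}"
      by (rule subspaceI) (simp_all add: act_add_right scale_right_distrib act_scale mult.commute)
    fix a w
    assume "w \<in> {v. act z v = scale \<mu> v}"
    then show "act a w \<in> {v. act z v = scale \<mu> v}"
      by (simp add: act_scale flip: act_mult central) (simp add: act_mult act_scale)
  qed
  with \<xi> generated have "{v. act z v = scale \<mu> v} = UNIV"
    by blast
  then show ?thesis by blast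
qed

text \<open>
  The last factor of a word acts first. Its column is the largest letter \<open>x\<close> of the sorted list \<open>g\<close>:
  a row index smaller than \<open>x\<close> gives a raising operator, which kills \<open>\<xi>\<close>, and a larger one does not occur in
  rearrangements of \<open>g\<close>. Only the diagonal entry remains, \<open>\<xi>\<close> is an eigenvector of it, and the argument
  repeats with the preceding factor.
\<close>

lemma act_word_sum:
  assumes "sorted g" and "\<And>f. \<alpha> f \<noteq> 0 \<Longrightarrow> mset f = mset g" and "length cs = length g"
  shows "act (\<Sum>f\<in>tuples (length g). of_int (\<alpha> f) * word ugl_gen (map of_int cs) f g) \<xi>
    = scale (of_int (\<alpha> g) * (\<Prod>r<length g. weight $ (g ! r) + of_int (cs ! r))) \<xi>"
  using assms
proof (induction g arbitrary: \<alpha> cs rule: rev_induct)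
  case Nil
  then show ?case by (simp add: act_of_int)
next
  case (snoc x g)
  obtain cs' c where cs: "cs = cs' @ [c]" and len: "length cs' = length g"
    using snoc.prems(3) by (metis append_butlast_last_id length_append_singleton length_butlast list.size(3) nat.distinct(1) diff_Suc_1)
  have le: "y \<le> x" if "y \<in> set g" for y
    using snoc.prems(1) that by (simp add: sorted_append)
  let ?w = "\<lambda>f. word ugl_gen (map of_int cs') f g"
  have summand: "act (of_int (\<alpha> (f @ [y])) * word ugl_gen (map of_int cs) (f @ [y]) (g @ [x])) \<xi>
      = (if y = x then scale (weight $ x + of_int c) (act (of_int (\<alpha> (f @ [x])) * ?w f) \<xi>) else 0)"
    if f: "f \<in> tuples (length g)" for f y
  proof -
    have "word ugl_gen (map of_int cs) (f @ [y]) (g @ [x])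
        = ?w f * (ugl_gen y x + (if y = x then of_int c else 0))"
      using f len by (simp add: cs word_append tuples_def)
    then have eq: "act (of_int (\<alpha> (f @ [y])) * word ugl_gen (map of_int cs) (f @ [y]) (g @ [x])) \<xi>
        = act (of_int (\<alpha> (f @ [y])) * ?w f) (act (ugl_gen y x + (if y = x then of_int c else 0)) \<xi>)"
      by (simp add: mult.assoc flip: act_mult)
    consider "y < x" | "y = x" | "x < y" by fastforce
    then show ?thesis
    proof cases
      case 1
      then show ?thesis using raising[OF 1] by (auto simp: eq)
    next
      case 2
      have "act (ugl_gen x x + of_int c) \<xi> = scale (weight $ x + of_int c) \<xi>"
        by (simp add: act_add_left weight act_of_int scale_left_distrib)
      with eq 2 show ?thesis
        by (simp add: act_scale)
    next
      case 3
      then have "y \<notin> set (g @ [x])" using le[of y] by (auto dest: leD)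
      moreover have "y \<in> set (f @ [y])" by simp
      ultimately have "\<alpha> (f @ [y]) = 0"
        using snoc.prems(2)[of "f @ [y]"] mset_eq_setD by blast
      with 3 show ?thesis by auto
    qed
  qed
  have "act (\<Sum>f\<in>tuples (length (g @ [x])). of_int (\<alpha> f) * word ugl_gen (map of_int cs) f (g @ [x])) \<xi>
      = (\<Sum>f\<in>tuples (length g). \<Sum>y\<in>UNIV.
          act (of_int (\<alpha> (f @ [y])) * word ugl_gen (map of_int cs) (f @ [y]) (g @ [x])) \<xi>)"
    by (simp add: sum_tuples_snoc act_sum)
  also have "\<dots> = (\<Sum>f\<in>tuples (length g).
      scale (weight $ x + of_int c) (act (of_int (\<alpha> (f @ [x])) * ?w f) \<xi>))"
    by (intro sum.cong refl) (simp add: summand)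
  also have "\<dots> = scale (weight $ x + of_int c)
      (act (\<Sum>f\<in>tuples (length g). of_int (\<alpha> (f @ [x])) * ?w f) \<xi>)"
    by (simp add: act_sum scale_sum_right)
  also have "act (\<Sum>f\<in>tuples (length g). of_int (\<alpha> (f @ [x])) * ?w f) \<xi>
      = scale (of_int (\<alpha> (g @ [x])) * (\<Prod>r<length g. weight $ (g ! r) + of_int (cs' ! r))) \<xi>"
  proof (rule snoc.IH)
    show "sorted g" using snoc.prems(1) by (simp add: sorted_append)
    show "mset f = mset g" if "\<alpha> (f @ [x]) \<noteq> 0" for f
      using snoc.prems(2)[OF that] by simp
  qed (rule len)
  also have "(\<Prod>r<length g. weight $ (g ! r) + of_int (cs' ! r))
      = (\<Prod>r<length g. weight $ ((g @ [x]) ! r) + of_int (cs ! r))"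
    by (intro prod.cong refl) (simp add: cs nth_append len)
  finally show ?case
    by (simp add: cs len nth_append mult.assoc mult.left_commute mult.commute)
qed

lemma act_capelli:
  assumes "sorted g"
  shows "act (capelli \<eta> ugl_gen g g) \<xi>
    = scale (of_int (kron \<eta> g g) * (\<Prod>r<length g. weight $ (g ! r) + of_int \<eta> * of_nat r)) \<xi>"
proof -
  have shifts: "capelli_shifts \<eta> (length g) = map of_int (map (\<lambda>r. \<eta> * int r) [0..<length g])"
    by (simp add: capelli_shifts_def)
  have "act (\<Sum>f\<in>tuples (length g). of_int (kron \<eta> f g)
        * word ugl_gen (map of_int (map (\<lambda>r. \<eta> * int r) [0..<length g])) f g) \<xi>
      = scale (of_int (kron \<eta> g g) * (\<Prod>r<length g.
          weight $ (g ! r) + of_int (map (\<lambda>r. \<eta> * int r) [0..<length g] ! r))) \<xi>"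
    using assms kron_support by (intro act_word_sum) auto
  then show ?thesis
    by (simp add: capelli_def shifts)
qed

text \<open>
  Grouping the index lists by their sorted rearrangements yields the shifted elementary
  (\<open>\<eta> = -1\<close>) or complete (\<open>\<eta> = 1\<close>) symmetric polynomial at the highest weight.
\<close>

lemma act_shifted_trace:
  assumes "\<eta> = 1 \<or> \<eta> = - 1"
  shows "act (shifted_trace \<eta> ugl_gen (capelli_shifts \<eta> m)) \<xi>
    = scale (fact m * (\<Sum>s | length s = m \<and> sorted s \<and> (\<eta> = 1 \<or> distinct s).
        \<Prod>r<m. weight $ (s ! r) + of_int \<eta> * of_nat r)) \<xi>"
proof -
  have \<eta>: "\<eta> * \<eta> = 1" using assms by auto
  define T where "T = {s :: 'n list. s \<in> tuples m \<and> sorted s}"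
  define w where "w s = (\<Prod>r<m. weight $ (s ! r) + of_int \<eta> * of_nat r)" for s
  have fin: "finite T" by (simp add: T_def)
  have "act (shifted_trace \<eta> ugl_gen (capelli_shifts \<eta> m)) \<xi>
      = (\<Sum>g\<in>tuples m. act (capelli \<eta> ugl_gen g g) \<xi>)"
    by (simp add: shifted_trace_capelli act_sum)
  also have "\<dots> = (\<Sum>s\<in>T. \<Sum>g\<in>{g \<in> tuples m. sort g = s}. act (capelli \<eta> ugl_gen g g) \<xi>)"
    by (rule sum.group[symmetric, OF finite_tuples fin]) (auto simp: T_def tuples_def)
  also have "\<dots> = (\<Sum>s\<in>T. scale (if \<eta> = 1 \<or> distinct s then fact m * w s else 0) \<xi>)"
  proof (intro sum.cong refl)
    fix s assume "s \<in> T"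
    then have s: "length s = m" "sorted s" by (auto simp: T_def tuples_def)
    have "{g \<in> tuples m. sort g = s} = {g. mset g = mset s}"
    proof (intro equalityI subsetI)
      fix g
      assume "g \<in> {g. mset g = mset s}"
      then show "g \<in> {g \<in> tuples m. sort g = s}"
        using s mset_eq_length[of g s] properties_for_sort[of s g] by (simp add: tuples_def)
    qed (auto simp: mset_sort)
    then have "(\<Sum>g\<in>{g \<in> tuples m. sort g = s}. act (capelli \<eta> ugl_gen g g) \<xi>)
        = (\<Sum>g\<in>{g. mset g = mset s}. act (capelli \<eta> ugl_gen s s) \<xi>)"
    proof (intro sum.cong)
      fix g
      assume "g \<in> {g. mset g = mset s}"
      then have "mset g = mset s" by simp
      from capelli_mset_eq[OF \<eta> gl_relations_ugl_gen this]
      show "act (capelli \<eta> ugl_gen g g) \<xi> = act (capelli \<eta> ugl_gen s s) \<xi>" by simp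
    qed
    also have "\<dots> = scale (of_int (int (card {g. mset g = mset s}) * kron \<eta> s s) * w s) \<xi>"
      using s by (simp add: act_capelli w_def sum_constant_scale mult.assoc)
    also have "\<dots> = scale (if \<eta> = 1 \<or> distinct s then fact m * w s else 0) \<xi>"
      unfolding kron_class_sum[OF assms] using s by simp
    finally show "(\<Sum>g\<in>{g \<in> tuples m. sort g = s}. act (capelli \<eta> ugl_gen g g) \<xi>)
      = scale (if \<eta> = 1 \<or> distinct s then fact m * w s else 0) \<xi>" .
  qed
  also have "\<dots> = scale (\<Sum>s\<in>T. if \<eta> = 1 \<or> distinct s then fact m * w s else 0) \<xi>"
    by (simp add: scale_sum_left)
  also have "(\<Sum>s\<in>T. if \<eta> = 1 \<or> distinct s then fact m * w s else 0)
      = (\<Sum>s\<in>{s \<in> T. \<eta> = 1 \<or> distinct s}. fact m * w s)"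
    by (rule sum.inter_filter[OF fin, symmetric])
  also have "{s \<in> T. \<eta> = 1 \<or> distinct s} = {s. length s = m \<and> sorted s \<and> (\<eta> = 1 \<or> distinct s)}"
    by (auto simp: T_def tuples_def)
  finally show ?thesis
    by (simp add: w_def sum_distrib_left)
qed

end

section \<open>Determinants as traces\<close>

lemma word_unshifted:
  "length f = m \<Longrightarrow> length g = m \<Longrightarrow>
    word X (replicate m 0) f g = prod_list (map (\<lambda>(i, j). X i j) (zip f g))"
proof (induction m arbitrary: f g)
  case (Suc m)
  then show ?case by (cases f; cases g) auto
qed simp

lemma word_uniform_shift:
  "length f = m \<Longrightarrow> length g = m \<Longrightarrow>
    word X (replicate m u) f g = word (\<lambda>i j. X i j + (if i = j then u else 0)) (replicate m 0) f g"
proof (induction m arbitrary: f g)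
  case (Suc m)
  then show ?case by (cases f; cases g) auto
qed simp

lemma distinct_list_UNIV:
  fixes f :: "'n::finite list"
  assumes "distinct f" "length f = CARD('n)"
  shows "set f = UNIV"
  using assms by (simp add: card_eq_UNIV_imp_eq_UNIV distinct_card)

text \<open>
  A transposition of values exchanges two letters of a list without repetitions, and both sides change
  their sign.
\<close>

lemma kron_map_permutation:
  fixes p :: "'n::finite \<Rightarrow> 'n"
  assumes f: "distinct f" "set f = UNIV" and p: "p permutes UNIV"
  shows "kron (- 1) f (map p f) = sign p"
  using p finite
proof (induction p rule: permutes_induct)
  case id
  show ?case using f by (simp add: kron_distinct)
next
  case (swap a b p)
  define g where "g = map p f"
  have inj: "inj p" using swap.hyps(4) by (rule permutes_inj)
  have g: "distinct g" "set g = UNIV"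
    using f inj swap.hyps(4) by (simp_all add: g_def distinct_map permutes_surj inj_on_subset)
  \<comment> \<open>Whichever of the two letters comes first in \<open>g\<close> takes the role of \<open>a\<close>.\<close>
  have exchange: "kron (- 1) f (map (Transposition.transpose a b) g) = - kron (- 1) f g"
    if ab: "a \<noteq> b" and split: "g = h @ a # k @ b # l" for a b h k l
  proof -
    have fixed: "map (Transposition.transpose a b) xs = xs" if "a \<notin> set xs" "b \<notin> set xs" for xs
      using that by (induction xs) (auto simp: Transposition.transpose_def)
    have "map (Transposition.transpose a b) g = h @ b # k @ a # l"
      using g(1) by (simp add: split fixed)
    then show ?thesis
      using swap_covariant_far_swap[OF _ swap_covariant_kron_right[of "- 1" f], of h b k a l]
      by (simp add: split)
  qed
  obtain h k where hk: "g = h @ a # k" using g(2) by (metis UNIV_I split_list)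
  have "b \<in> set h \<or> b \<in> set k" using g(2) hk swap.hyps(3) by (metis UNIV_I in_set_conv_decomp Un_iff set_append set_ConsD)
  then have "kron (- 1) f (map (Transposition.transpose a b) g) = - kron (- 1) f g"
  proof
    assume "b \<in> set h"
    then obtain h1 h2 where "h = h1 @ b # h2" by (meson split_list)
    then show ?thesis
      using exchange[of b a h1 h2 k] hk swap.hyps(3) by (simp add: Transposition.transpose_commute)
  next
    assume "b \<in> set k"
    then obtain k1 k2 where "k = k1 @ b # k2" by (meson split_list)
    then show ?thesis
      using exchange[of a b h k1 k2] hk swap.hyps(3) by simp
  qed
  moreover have "map (Transposition.transpose a b \<circ> p) f = map (Transposition.transpose a b) g"
    by (simp add: g_def)
  moreover have "sign (Transposition.transpose a b \<circ> p) = - sign p"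
    using swap.hyps by (simp add: sign_compose sign_swap_id permutation_swap_id permutation_permutes[of p] exI[of _ UNIV])
  ultimately show ?case using swap.IH by (simp only: g_def)
qed

text \<open>
  Each of the \<open>N!\<close> orderings \<open>f\<close> of the rows contributes the full Leibniz sum over the columns, and lists
  with repetitions contribute nothing.
\<close>

lemma shifted_trace_det:
  fixes A :: "'a::comm_ring_1 ^ 'n::finite ^ 'n"
  shows "shifted_trace (- 1) (\<lambda>i j. A $ i $ j) (replicate CARD('n) 0) = of_nat (fact CARD('n)) * det A"
proof -
  let ?W = "word (\<lambda>i j. A $ i $ j) (replicate CARD('n) 0)"
  have row: "(\<Sum>g\<in>tuples CARD('n). of_int (kron (- 1) f g) * ?W f g) = det A"
    if f: "f \<in> permutations_of_set (UNIV :: 'n set)" for f :: "'n list"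
  proof -
    have df: "distinct f" "set f = UNIV"
      using f by (auto simp: permutations_of_set_def)
    have len: "length f = CARD('n)"
      using distinct_card[OF df(1)] df(2) by simp
    have inj: "inj_on (\<lambda>p. map p f) {p. p permutes UNIV}"
      using df by (auto simp: inj_on_def)
    \<comment> \<open>There are equally many permutations and rearrangements, so the inclusion is an equality.\<close>
    have image: "(\<lambda>p. map p f) ` {p. p permutes UNIV} = {g. mset g = mset f}"
    proof (rule card_subset_eq)
      have eq: "{g. mset g = mset f} = permutations_of_set (UNIV :: 'n set)"
        using df by (auto simp: permutations_of_set_def dest: mset_eq_setD mset_eq_imp_distinct_iff)
          (metis set_eq_iff_mset_eq_distinct)
      show "finite {g. mset g = mset f}" by (simp add: eq)
      show "card ((\<lambda>p. map p f) ` {p. p permutes UNIV}) = card {g. mset g = mset f}"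
        by (simp add: eq card_image[OF inj] card_permutations[of UNIV "CARD('n)"])
      show "(\<lambda>p. map p f) ` {p. p permutes UNIV} \<subseteq> {g. mset g = mset f}"
      proof clarify
        fix p :: "'n \<Rightarrow> 'n"
        assume p: "p permutes UNIV"
        have "distinct (map p f)" "set (map p f) = set f"
          using df p by (simp_all add: distinct_map permutes_inj inj_on_subset permutes_surj)
        then show "mset (map p f) = mset f"
          using df by (metis set_eq_iff_mset_eq_distinct)
      qed
    qed
    have "(\<Sum>g\<in>tuples CARD('n). of_int (kron (- 1) f g) * ?W f g)
        = (\<Sum>g\<in>{g. mset g = mset f}. of_int (kron (- 1) f g) * ?W f g)"
    proof (rule sum.mono_neutral_right)
      show "{g. mset g = mset f} \<subseteq> tuples CARD('n)"
        using len by (auto simp: tuples_def dest: mset_eq_length)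
      show "\<forall>g\<in>tuples CARD('n) - {g. mset g = mset f}. of_int (kron (- 1) f g) * ?W f g = 0"
      proof
        fix g
        assume "g \<in> tuples CARD('n) - {g. mset g = mset f}"
        then have "kron (- 1) f g = 0" using kron_support[of "- 1" f g] by force
        then show "of_int (kron (- 1) f g) * ?W f g = 0" by simp
      qed
    qed simp
    also have "\<dots> = (\<Sum>p | p permutes UNIV. of_int (kron (- 1) f (map p f)) * ?W f (map p f))"
      unfolding image[symmetric] by (simp add: sum.reindex[OF inj])
    also have "\<dots> = (\<Sum>p | p permutes UNIV. of_int (sign p) * (\<Prod>i\<in>UNIV. A $ i $ p i))"
    proof (intro sum.cong refl)
      fix p :: "'n \<Rightarrow> 'n"
      assume "p \<in> {p. p permutes UNIV}"
      then have p: "p permutes UNIV" by simp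
      have "map (\<lambda>(i, j). A $ i $ j) (zip f (map p f)) = map (\<lambda>i. A $ i $ p i) f" for f
        by (induction f) auto
      then have "?W f (map p f) = prod_list (map (\<lambda>i. A $ i $ p i) f)"
        using len by (simp add: word_unshifted)
      also have "\<dots> = (\<Prod>i\<in>UNIV. A $ i $ p i)"
        using prod.distinct_set_conv_list[OF df(1), of "\<lambda>i. A $ i $ p i"] df(2) by simp
      finally show "of_int (kron (- 1) f (map p f)) * ?W f (map p f)
          = of_int (sign p) * (\<Prod>i\<in>UNIV. A $ i $ p i)"
        by (simp add: kron_map_permutation[OF df p])
    qed
    finally show ?thesis by (simp add: det_def)
  qed
  have "shifted_trace (- 1) (\<lambda>i j. A $ i $ j) (replicate CARD('n) 0)
      = (\<Sum>f\<in>permutations_of_set UNIV. \<Sum>g\<in>tuples CARD('n). of_int (kron (- 1) f g) * ?W f g)"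
    unfolding shifted_trace_def length_replicate
  proof (rule sum.mono_neutral_right)
    show "permutations_of_set (UNIV :: 'n set) \<subseteq> tuples CARD('n)"
    proof
      fix f :: "'n list"
      assume "f \<in> permutations_of_set UNIV"
      then have "set f = UNIV" "distinct f" by (auto simp: permutations_of_set_def)
      then show "f \<in> tuples CARD('n)"
        using distinct_card[of f] by (simp add: tuples_def)
    qed
    show "\<forall>f\<in>tuples CARD('n) - permutations_of_set UNIV.
        (\<Sum>g\<in>tuples CARD('n). of_int (kron (- 1) f g) * ?W f g) = 0"
    proof
      fix f :: "'n list"
      assume "f \<in> tuples CARD('n) - permutations_of_set UNIV"
      then have "\<not> distinct f"
        using distinct_list_UNIV[of f] by (auto simp: tuples_def permutations_of_set_def)
      then have "kron (- 1) f g = 0" for g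
        using swap_covariant_not_distinct[OF swap_covariant_kron_left[of "- 1" g]] by simp
      then show "(\<Sum>g\<in>tuples CARD('n). of_int (kron (- 1) f g) * ?W f g) = 0"
        by simp
    qed
  qed simp
  also have "\<dots> = (\<Sum>f\<in>permutations_of_set (UNIV :: 'n set). det A)"
    by (intro sum.cong refl row)
  finally show ?thesis by simp
qed

text \<open>
  The characteristic polynomial. The determinant of \<open>X + u\<close> is a trace with \<open>N\<close> shifts \<open>u\<close>, and removing
  the shifts one by one leaves traces of lower degree with binomial coefficients.
\<close>

lemma det_shift_expansion:
  fixes X :: "'n::finite \<Rightarrow> 'n \<Rightarrow> 'a::comm_ring_1"
  shows "of_nat (fact CARD('n)) * det (\<chi> i j. X i j + (if i = j then u else 0))
    = (\<Sum>k\<le>CARD('n). of_nat ((CARD('n) choose k) * fact (CARD('n) - k)) * u ^ (CARD('n) - k)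
        * shifted_trace (- 1) X (replicate k 0))"
proof -
  let ?N = "CARD('n)"
  define U where "U j i = shifted_trace (- 1) X (replicate j u @ replicate i 0)" for j i
  have step: "U (Suc j) i = U j (Suc i) + u * of_int (int ?N + (- 1) * int (j + i)) * U j i" for j i
    using shifted_trace_shift[where \<eta> = "- 1" and d = u and c = 0 and X = X
        and ?cs1.0 = "replicate j u" and ?cs2.0 = "replicate i 0"]
    by (simp add: U_def mult.commute replicate_app_Cons_same)
  have "of_nat (fact ?N) * det (\<chi> i j. X i j + (if i = j then u else 0)) = U ?N 0"
  proof -
    have "of_nat (fact ?N) * det (\<chi> i j. X i j + (if i = j then u else 0))
        = shifted_trace (- 1) (\<lambda>i j. X i j + (if i = j then u else 0)) (replicate ?N 0)"
      unfolding shifted_trace_det[symmetric]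
      by (intro arg_cong2[of _ _ _ _ "shifted_trace (- 1)"] ext refl) simp
    also have "\<dots> = shifted_trace (- 1) X (replicate ?N u)"
      unfolding shifted_trace_def length_replicate
      by (intro sum.cong refl arg_cong2[of _ _ _ _ "(*)"] word_uniform_shift[symmetric])
        (simp_all add: tuples_def)
    finally show ?thesis by (simp add: U_def)
  qed
  also have "\<dots> = (\<Sum>k\<le>?N. of_nat (?N choose k) * u ^ (?N - k)
      * of_int (\<Prod>r\<in>{0 + k..<0 + ?N}. int ?N + (- 1) * int r) * U 0 (0 + k))"
    by (rule binomial_expansion[OF step])
  also have "\<dots> = (\<Sum>k\<le>?N. of_nat ((?N choose k) * fact (?N - k)) * u ^ (?N - k)
        * shifted_trace (- 1) X (replicate k 0))"
  proof (intro sum.cong refl)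
    fix k assume "k \<in> {..?N}"
    then have k: "k \<le> ?N" by simp
    have "(\<Prod>r\<in>{k..<?N}. int ?N + (- 1) * int r) = int (\<Prod>r\<in>{k..<?N}. ?N - r)"
      by (simp add: of_nat_diff)
    also have "(\<Prod>r\<in>{k..<?N}. ?N - r) = \<Prod>{1..?N - k}"
      by (rule prod.reindex_bij_witness[of _ "\<lambda>s. ?N - s" "\<lambda>r. ?N - r"]) (use k in auto)
    also have "\<dots> = fact (?N - k)"
      by (simp add: fact_prod)
    finally show "of_nat (?N choose k) * u ^ (?N - k)
          * of_int (\<Prod>r\<in>{0 + k..<0 + ?N}. int ?N + (- 1) * int r) * U 0 (0 + k)
        = of_nat ((?N choose k) * fact (?N - k)) * u ^ (?N - k) * shifted_trace (- 1) X (replicate k 0)"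
      by (simp add: U_def mult_ac del: of_nat_fact)
  qed
  finally show ?thesis .
qed

text \<open>
  Naturality and homogeneity, for the passage from \<open>S(gl_N)\<close> to polynomials and power series over it.
\<close>

lemma shifted_trace_hom:
  fixes X :: "'n::finite \<Rightarrow> 'n \<Rightarrow> 'a::ring_1" and h :: "'a \<Rightarrow> 'b::comm_ring_1"
  assumes add: "\<And>x y. h (x + y) = h x + h y" and mult: "\<And>x y. h (x * y) = h x * h y"
    and one: "h 1 = 1"
  shows "shifted_trace \<eta> (\<lambda>i j. c * h (X i j)) (replicate m 0)
    = c ^ m * h (shifted_trace \<eta> X (replicate m 0))"
proof -
  have zero: "h 0 = 0" using add[of 0 0] by simp
  have uminus: "h (- x) = - h x" for x
    using add[of x "- x"] zero by (simp add: add_eq_0_iff)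
  have nat: "h (of_nat n) = of_nat n" for n
    by (induction n) (simp_all add: zero add one)
  have int: "h (of_int z) = of_int z" for z
    by (cases z rule: int_cases2) (simp_all add: nat uminus)
  have sum: "h (\<Sum>x\<in>S. F x) = (\<Sum>x\<in>S. h (F x))" for S and F :: "'c \<Rightarrow> 'a"
    by (induction S rule: infinite_finite_induct) (simp_all add: zero add)
  have word: "word (\<lambda>i j. c * h (X i j)) (replicate m 0) f g = c ^ m * h (word X (replicate m 0) f g)"
    if "f \<in> tuples m" "g \<in> tuples m" for f g
  proof -
    have "length f = m \<Longrightarrow> length g = m \<Longrightarrow> ?thesis"
    proof (induction m arbitrary: f g)
      case (Suc m)
      then show ?case by (cases f; cases g) (auto simp: mult mult_ac)
    qed (simp add: one)
    then show ?thesis using that by (simp add: tuples_def)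
  qed
  show ?thesis
    unfolding shifted_trace_def length_replicate
    by (simp add: sum mult int sum_distrib_left word mult_ac)
qed

section \<open>Newton identities\<close>

text \<open>
  In a commutative ring the letters of both words can be permuted simultaneously, so the position that
  the contraction removes may be assumed to be the first one. This gives one and the same
  contribution for each of the positions.
\<close>

lemma contract_word_sum:
  fixes X :: "'n::finite \<Rightarrow> 'n \<Rightarrow> 'a::comm_ring_1"
  assumes \<eta>: "\<eta> * \<eta> = 1" and "\<And>h. swap_covariant \<eta> (\<lambda>f. \<psi> f h)"
  shows "(\<Sum>f\<in>tuples (Suc m). \<Sum>g\<in>tuples (Suc m).
        of_int (contract \<eta> i (\<psi> f) g) * word X (replicate (Suc m) 0) f g)
    = of_nat (Suc m) * (\<Sum>l\<in>UNIV. X l i * (\<Sum>f\<in>tuples m. \<Sum>g\<in>tuples m.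
        of_int (\<psi> (l # f) g) * word X (replicate m 0) f g))"
  using assms(2)
proof (induction m arbitrary: \<psi>)
  case 0
  show ?case
    by (simp add: sum_tuples_1 if_distrib[of of_int] if_distrib[of "\<lambda>x. x * _"] mult.commute cong: if_cong)
next
  case (Suc m)
  let ?W = "word X (replicate (Suc m) 0)" and ?w = "word X (replicate m 0)"
  have swap: "\<eta> * \<psi> (a # l # f) h = \<psi> (l # a # f) h" for a l f h
    using swap_covariantD[OF Suc.prems, of "[]" l a f h] by simp
  have prems: "swap_covariant \<eta> (\<lambda>f. \<psi> (a # f) (b # h))" for a b h
    using swap_covariant_Cons[OF Suc.prems] .
  have first: "(\<Sum>a\<in>UNIV. \<Sum>b\<in>UNIV. \<Sum>f\<in>tuples (Suc m). \<Sum>g\<in>tuples (Suc m).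
        of_int (if i = b then \<psi> (a # f) g else 0) * (X a b * ?W f g))
      = (\<Sum>l\<in>UNIV. X l i * (\<Sum>f\<in>tuples (Suc m). \<Sum>g\<in>tuples (Suc m). of_int (\<psi> (l # f) g) * ?W f g))"
  proof (intro sum.cong refl)
    fix a
    have "(\<Sum>b\<in>UNIV. \<Sum>f\<in>tuples (Suc m). \<Sum>g\<in>tuples (Suc m).
        of_int (if i = b then \<psi> (a # f) g else 0) * (X a b * ?W f g))
      = (\<Sum>b\<in>UNIV. if i = b then X a b * (\<Sum>f\<in>tuples (Suc m). \<Sum>g\<in>tuples (Suc m).
        of_int (\<psi> (a # f) g) * ?W f g) else 0)"
      by (intro sum.cong refl) (simp add: sum_distrib_left mult.left_commute)
    then show "(\<Sum>b\<in>UNIV. \<Sum>f\<in>tuples (Suc m). \<Sum>g\<in>tuples (Suc m).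
        of_int (if i = b then \<psi> (a # f) g else 0) * (X a b * ?W f g))
      = X a i * (\<Sum>f\<in>tuples (Suc m). \<Sum>g\<in>tuples (Suc m). of_int (\<psi> (a # f) g) * ?W f g)"
      by simp
  qed
  have second: "(\<Sum>a\<in>UNIV. \<Sum>b\<in>UNIV. \<Sum>f\<in>tuples (Suc m). \<Sum>g\<in>tuples (Suc m).
        of_int (\<eta> * contract \<eta> i (\<lambda>h. \<psi> (a # f) (b # h)) g) * (X a b * ?W f g))
      = of_nat (Suc m) * (\<Sum>l\<in>UNIV. X l i * (\<Sum>f\<in>tuples (Suc m). \<Sum>g\<in>tuples (Suc m).
          of_int (\<psi> (l # f) g) * ?W f g))"
  proof -
    have "(\<Sum>f\<in>tuples (Suc m). \<Sum>g\<in>tuples (Suc m).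
        of_int (\<eta> * contract \<eta> i (\<lambda>h. \<psi> (a # f) (b # h)) g) * (X a b * ?W f g))
      = (\<Sum>l\<in>UNIV. of_nat (Suc m) * (X l i * (\<Sum>f\<in>tuples m. \<Sum>g\<in>tuples m.
          of_int (\<psi> (l # a # f) (b # g)) * (X a b * ?w f g))))" for a b
    proof -
      have "(\<Sum>f\<in>tuples (Suc m). \<Sum>g\<in>tuples (Suc m).
          of_int (\<eta> * contract \<eta> i (\<lambda>h. \<psi> (a # f) (b # h)) g) * (X a b * ?W f g))
        = of_int \<eta> * X a b * (\<Sum>f\<in>tuples (Suc m). \<Sum>g\<in>tuples (Suc m).
          of_int (contract \<eta> i (\<lambda>h. \<psi> (a # f) (b # h)) g) * ?W f g)"
        unfolding sum_distrib_left by (intro sum.cong refl) (simp only: of_int_mult mult_ac)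
      also have "\<dots> = of_int \<eta> * X a b * (of_nat (Suc m) * (\<Sum>l\<in>UNIV. X l i *
          (\<Sum>f\<in>tuples m. \<Sum>g\<in>tuples m. of_int (\<psi> (a # l # f) (b # g)) * ?w f g)))"
        by (simp only: Suc.IH[OF prems])
      also have "\<dots> = (\<Sum>l\<in>UNIV. of_nat (Suc m) * (X l i * (\<Sum>f\<in>tuples m. \<Sum>g\<in>tuples m.
          of_int (\<eta> * \<psi> (a # l # f) (b # g)) * (X a b * ?w f g))))"
        unfolding sum_distrib_left by (intro sum.cong refl) (simp only: of_int_mult mult_ac)
      finally show ?thesis by (simp only: swap)
    qed
    then have "(\<Sum>a\<in>UNIV. \<Sum>b\<in>UNIV. \<Sum>f\<in>tuples (Suc m). \<Sum>g\<in>tuples (Suc m).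
        of_int (\<eta> * contract \<eta> i (\<lambda>h. \<psi> (a # f) (b # h)) g) * (X a b * ?W f g))
      = (\<Sum>a\<in>UNIV. \<Sum>b\<in>UNIV. \<Sum>l\<in>UNIV. of_nat (Suc m) * (X l i * (\<Sum>f\<in>tuples m. \<Sum>g\<in>tuples m.
          of_int (\<psi> (l # a # f) (b # g)) * (X a b * ?w f g))))"
      by (simp only:)
    also have "\<dots> = (\<Sum>a\<in>UNIV. \<Sum>l\<in>UNIV. \<Sum>b\<in>UNIV. of_nat (Suc m) * (X l i * (\<Sum>f\<in>tuples m. \<Sum>g\<in>tuples m.
          of_int (\<psi> (l # a # f) (b # g)) * (X a b * ?w f g))))"
      by (intro sum.cong refl sum.swap)
    also have "\<dots> = (\<Sum>l\<in>UNIV. \<Sum>a\<in>UNIV. \<Sum>b\<in>UNIV. of_nat (Suc m) * (X l i * (\<Sum>f\<in>tuples m. \<Sum>g\<in>tuples m.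
          of_int (\<psi> (l # a # f) (b # g)) * (X a b * ?w f g))))"
      by (rule sum.swap)
    also have "\<dots> = (\<Sum>l\<in>UNIV. of_nat (Suc m) * (X l i * (\<Sum>f\<in>tuples (Suc m). \<Sum>g\<in>tuples (Suc m).
          of_int (\<psi> (l # f) g) * ?W f g)))"
      by (simp add: sum_tuples_Suc2 sum_distrib_left)
    finally show ?thesis by (simp only: sum_distrib_left)
  qed
  show ?case
    unfolding sum_tuples_Suc2[of _ "Suc m"] replicate_Suc[of "Suc m"] word_Cons contract.simps
      of_int_add distrib_right sum.distrib if_cancel add_0_right
    unfolding first second by (simp add: distrib_right)
qed

definition matrix_product :: "('n::finite \<Rightarrow> 'n \<Rightarrow> 'a::comm_ring_1) \<Rightarrow> ('n \<Rightarrow> 'n \<Rightarrow> 'a) \<Rightarrow> 'n \<Rightarrow> 'n \<Rightarrow> 'a"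
  where "matrix_product X A i j = (\<Sum>l\<in>UNIV. X i l * A l j)"

text \<open>
  \<open>(m + 1)! tr P (A \<otimes> X \<otimes> ... \<otimes> X)\<close> with the (anti)symmetrizer \<open>P\<close> of \<open>m + 1\<close> tensor factors, and an arbitrary
  matrix \<open>A\<close> in the first of them. The weight \<open>A\<close> is what makes the Laplace expansion recursive.
\<close>

definition weighted_trace ::
  "int \<Rightarrow> ('n::finite \<Rightarrow> 'n \<Rightarrow> 'a::comm_ring_1) \<Rightarrow> nat \<Rightarrow> ('n \<Rightarrow> 'n \<Rightarrow> 'a) \<Rightarrow> 'a" where
  "weighted_trace \<eta> X m A = (\<Sum>i\<in>UNIV. \<Sum>j\<in>UNIV. A i j * (\<Sum>f\<in>tuples m. \<Sum>g\<in>tuples m.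
    of_int (kron \<eta> (i # f) (j # g)) * word X (replicate m 0) f g))"

lemma weighted_trace_self:
  "weighted_trace \<eta> X m X = shifted_trace \<eta> X (replicate (Suc m) 0)"
  unfolding weighted_trace_def shifted_trace_def length_replicate sum_tuples_Suc2 sum_distrib_left
  by (intro sum.cong refl) (simp add: mult.left_commute del: kron.simps)

lemma weighted_trace_0: "weighted_trace \<eta> X 0 A = (\<Sum>i\<in>UNIV. A i i)"
  by (simp add: weighted_trace_def if_distrib[of of_int] if_distrib[of "\<lambda>x. _ * x"] cong: if_cong)

text \<open>
  Expansion along the first row: the index of the first factor is closed with itself, giving the trace
  of the matrix, or it is linked to one of the other factors, whose matrix is then multiplied to it.
\<close>

lemma weighted_trace_Suc:
  fixes X :: "'n::finite \<Rightarrow> 'n \<Rightarrow> 'a::comm_ring_1"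
  assumes \<eta>: "\<eta> * \<eta> = 1"
  shows "weighted_trace \<eta> X (Suc m) A = (\<Sum>i\<in>UNIV. A i i) * shifted_trace \<eta> X (replicate (Suc m) 0)
    + of_int \<eta> * of_nat (Suc m) * weighted_trace \<eta> X m (matrix_product X A)"
proof -
  let ?W = "word X (replicate (Suc m) 0)" and ?w = "word X (replicate m 0)"
  \<comment> \<open>Laplace expansion along the row \<open>i\<close>.\<close>
  have head: "(\<Sum>f\<in>tuples (Suc m). \<Sum>g\<in>tuples (Suc m). of_int (kron \<eta> (i # f) (j # g)) * ?W f g)
      = (if i = j then shifted_trace \<eta> X (replicate (Suc m) 0) else 0)
        + of_int \<eta> * of_nat (Suc m) * (\<Sum>l\<in>UNIV. X l i * (\<Sum>f\<in>tuples m. \<Sum>g\<in>tuples m.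
            of_int (kron \<eta> (l # f) (j # g)) * ?w f g))" for i j
  proof -
    have "(\<Sum>f\<in>tuples (Suc m). \<Sum>g\<in>tuples (Suc m). of_int (kron \<eta> (i # f) (j # g)) * ?W f g)
      = (\<Sum>f\<in>tuples (Suc m). \<Sum>g\<in>tuples (Suc m). of_int (if i = j then kron \<eta> f g else 0) * ?W f g)
        + of_int \<eta> * (\<Sum>f\<in>tuples (Suc m). \<Sum>g\<in>tuples (Suc m).
            of_int (contract \<eta> i (\<lambda>h. kron \<eta> f (j # h)) g) * ?W f g)"
      unfolding sum_distrib_left sum.distrib[symmetric]
      by (intro sum.cong refl) (simp add: algebra_simps)
    also have "(\<Sum>f\<in>tuples (Suc m). \<Sum>g\<in>tuples (Suc m).
            of_int (contract \<eta> i (\<lambda>h. kron \<eta> f (j # h)) g) * ?W f g)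
      = of_nat (Suc m) * (\<Sum>l\<in>UNIV. X l i * (\<Sum>f\<in>tuples m. \<Sum>g\<in>tuples m.
            of_int (kron \<eta> (l # f) (j # g)) * ?w f g))"
      by (rule contract_word_sum[OF \<eta> swap_covariant_kron_left[OF \<eta>]])
    also have "(\<Sum>f\<in>tuples (Suc m). \<Sum>g\<in>tuples (Suc m). of_int (if i = j then kron \<eta> f g else 0) * ?W f g)
      = (if i = j then shifted_trace \<eta> X (replicate (Suc m) 0) else 0)"
      by (simp add: shifted_trace_def)
    finally show ?thesis by (simp only: mult.assoc)
  qed
  have "weighted_trace \<eta> X (Suc m) A
      = (\<Sum>i\<in>UNIV. \<Sum>j\<in>UNIV. if i = j then A i j * shifted_trace \<eta> X (replicate (Suc m) 0) else 0)
        + of_int \<eta> * of_nat (Suc m) * (\<Sum>i\<in>UNIV. \<Sum>j\<in>UNIV. \<Sum>l\<in>UNIV. X l i * A i j * (\<Sum>f\<in>tuples m. \<Sum>g\<in>tuples m.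
            of_int (kron \<eta> (l # f) (j # g)) * ?w f g))"
    unfolding weighted_trace_def head distrib_left sum.distrib
    by (intro arg_cong2[of _ _ _ _ "(+)"] sum.cong refl)
      (simp_all add: sum_distrib_left mult_ac del: kron.simps replicate_Suc)
  also have "(\<Sum>i\<in>UNIV. \<Sum>j\<in>UNIV. \<Sum>l\<in>UNIV. X l i * A i j * (\<Sum>f\<in>tuples m. \<Sum>g\<in>tuples m.
            of_int (kron \<eta> (l # f) (j # g)) * ?w f g))
      = weighted_trace \<eta> X m (matrix_product X A)"
  proof -
    let ?t = "\<lambda>i j l. X l i * A i j * (\<Sum>f\<in>tuples m. \<Sum>g\<in>tuples m.
            of_int (kron \<eta> (l # f) (j # g)) * ?w f g)"
    have "(\<Sum>i\<in>UNIV. \<Sum>j\<in>UNIV. \<Sum>l\<in>UNIV. ?t i j l) = (\<Sum>i\<in>UNIV. \<Sum>l\<in>UNIV. \<Sum>j\<in>UNIV. ?t i j l)"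
      by (intro sum.cong refl sum.swap)
    also have "\<dots> = (\<Sum>l\<in>UNIV. \<Sum>i\<in>UNIV. \<Sum>j\<in>UNIV. ?t i j l)"
      by (rule sum.swap)
    also have "\<dots> = (\<Sum>l\<in>UNIV. \<Sum>j\<in>UNIV. \<Sum>i\<in>UNIV. ?t i j l)"
      by (intro sum.cong refl sum.swap)
    finally show ?thesis
      by (simp only: weighted_trace_def matrix_product_def sum_distrib_right)
  qed
  finally show ?thesis by (simp add: sum_distrib_right del: replicate_Suc)
qed

text \<open>
  \<open>tr X\<^sup>k A\<close>; the weight \<open>A\<close> accumulates the powers of \<open>X\<close>.
\<close>

primrec power_sum :: "('n::finite \<Rightarrow> 'n \<Rightarrow> 'a::comm_ring_1) \<Rightarrow> ('n \<Rightarrow> 'n \<Rightarrow> 'a) \<Rightarrow> nat \<Rightarrow> 'a" where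
  "power_sum X A 0 = (\<Sum>i\<in>UNIV. A i i)"
| "power_sum X A (Suc k) = power_sum X (matrix_product X A) k"

text \<open>
  The hypothesis on \<open>c\<close> says that \<open>c m = c 0 / m!\<close>, in a form that makes sense in any commutative ring.
\<close>

lemma weighted_trace_expansion:
  fixes X :: "'n::finite \<Rightarrow> 'n \<Rightarrow> 'a::comm_ring_1"
  assumes \<eta>: "\<eta> * \<eta> = 1" and c: "\<And>m. c (Suc m) * of_nat (Suc m) = c m"
  shows "c m * weighted_trace \<eta> X m A
    = (\<Sum>k\<le>m. of_int \<eta> ^ k * power_sum X A k * (c (m - k) * shifted_trace \<eta> X (replicate (m - k) 0)))"
proof (induction m arbitrary: A)
  case 0
  show ?case by (simp add: weighted_trace_0 shifted_trace_def mult.commute)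
next
  case (Suc m)
  have "c (Suc m) * weighted_trace \<eta> X (Suc m) A
      = power_sum X A 0 * (c (Suc m) * shifted_trace \<eta> X (replicate (Suc m) 0))
        + of_int \<eta> * (c (Suc m) * of_nat (Suc m) * weighted_trace \<eta> X m (matrix_product X A))"
    unfolding weighted_trace_Suc[OF \<eta>] by (simp only: power_sum.simps distrib_left mult_ac)
  also have "of_int \<eta> * (c (Suc m) * of_nat (Suc m) * weighted_trace \<eta> X m (matrix_product X A))
      = (\<Sum>k\<le>m. of_int \<eta> ^ Suc k * power_sum X A (Suc k)
          * (c (Suc m - Suc k) * shifted_trace \<eta> X (replicate (Suc m - Suc k) 0)))"
    unfolding c Suc.IH sum_distrib_left
    by (intro sum.cong refl) (simp add: mult_ac)
  finally show ?case
    by (subst sum.atMost_Suc_shift) simp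
qed

text \<open>
  The Newton identities between power sums and elementary (\<open>\<eta> = -1\<close>) or complete (\<open>\<eta> = 1\<close>) symmetric
  functions of a matrix: iterated expansion with weight \<open>X\<close> itself.
\<close>

lemma newton_identity:
  fixes X :: "'n::finite \<Rightarrow> 'n \<Rightarrow> 'a::comm_ring_1"
  assumes \<eta>: "\<eta> * \<eta> = 1" and c: "\<And>m. c (Suc m) * of_nat (Suc m) = c m"
  shows "of_nat (Suc m) * (c (Suc m) * shifted_trace \<eta> X (replicate (Suc m) 0))
    = (\<Sum>k\<le>m. of_int \<eta> ^ k * power_sum X X k * (c (m - k) * shifted_trace \<eta> X (replicate (m - k) 0)))"
proof -
  have "of_nat (Suc m) * (c (Suc m) * shifted_trace \<eta> X (replicate (Suc m) 0))
      = c m * weighted_trace \<eta> X m X"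
    unfolding weighted_trace_self c[of m, symmetric] by (simp only: mult_ac)
  then show ?thesis
    by (simp only: weighted_trace_expansion[where c = c, OF \<eta> c])
qed

section \<open>The invariants as traces\<close>

definition sgl_const :: "complex \<Rightarrow> 'n sgl" where
  "sgl_const = Poly_Mapping.single 0"

lemma sgl_const_mult: "sgl_const (a * b) = sgl_const a * sgl_const b"
  by (simp add: sgl_const_def mult_single)

lemma sgl_const_of_nat: "sgl_const (of_nat n) = of_nat n"
  by (simp add: sgl_const_def)

lemma sgl_const_of_int: "sgl_const (of_int z) = of_int z"
  by (simp add: sgl_const_def)

lemma sgl_const_inverse_of_nat:
  fixes x :: "'n sgl"
  assumes "n \<noteq> 0"
  shows "sgl_const (1 / of_nat n) * (of_nat n * x) = x"
proof -
  have "sgl_const (1 / of_nat n) * of_nat n = (sgl_const (1 / of_nat n * of_nat n) :: 'n sgl)"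
    by (simp only: sgl_const_mult sgl_const_of_nat)
  also have "1 / of_nat n * of_nat n = (of_nat 1 :: complex)"
    using assms by simp
  finally have "sgl_const (1 / of_nat n) * of_nat n = (1 :: 'n sgl)"
    by (simp add: sgl_const_def)
  then show ?thesis
    by (simp only: mult.assoc[symmetric] mult_1_left)
qed

text \<open>
  The ring \<open>S(gl_N)\<close> contains the rational numbers, so positive integers are invertible in it.
\<close>

lemma sgl_of_nat_cancel:
  fixes x y :: "'n sgl"
  assumes "of_nat n * x = of_nat n * y" "n \<noteq> 0"
  shows "x = y"
  by (metis assms sgl_const_inverse_of_nat)

abbreviation inv_fact :: "nat \<Rightarrow> 'n sgl" where
  "inv_fact m \<equiv> sgl_const (1 / of_nat (fact m))"

lemma inv_fact_Suc: "inv_fact (Suc m) * of_nat (Suc m) = inv_fact m"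
proof -
  have "inv_fact (Suc m) * of_nat (Suc m) = sgl_const (1 / of_nat (fact (Suc m)) * of_nat (Suc m))"
    by (simp only: sgl_const_mult sgl_const_of_nat)
  also have "1 / of_nat (fact (Suc m)) * of_nat (Suc m) = (1 / of_nat (fact m) :: complex)"
    unfolding fact_Suc of_nat_mult by (simp add: field_simps del: of_nat_Suc)
  finally show ?thesis .
qed

text \<open>
  The common form \<open>tr A E\<^sub>1 ... E\<^sub>m\<close> of the two families of invariants.
\<close>

definition sgl_invariant :: "int \<Rightarrow> nat \<Rightarrow> 'n::finite sgl" where
  "sgl_invariant \<eta> m = inv_fact m * shifted_trace \<eta> sgl_gen (replicate m 0)"

lemma of_nat_fact_sgl_invariant:
  "of_nat (fact m) * sgl_invariant \<eta> m = shifted_trace \<eta> sgl_gen (replicate m 0)"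
  using sgl_const_inverse_of_nat[of "fact m"] by (simp add: sgl_invariant_def mult.left_commute)

lemma sgl_invariant_0: "sgl_invariant \<eta> 0 = 1"
  by (simp add: sgl_invariant_def shifted_trace_def sgl_const_def)

lemma choose_fact_sgl_invariant:
  assumes "m \<le> N"
  shows "of_nat ((N choose m) * fact (N - m)) * shifted_trace \<eta> sgl_gen (replicate m 0)
    = of_nat (fact N) * sgl_invariant \<eta> m"
proof -
  have "of_nat ((N choose m) * fact (N - m)) * shifted_trace \<eta> sgl_gen (replicate m 0)
      = of_nat (fact m * fact (N - m) * (N choose m)) * sgl_invariant \<eta> m"
    unfolding of_nat_fact_sgl_invariant[symmetric] by (simp only: of_nat_mult mult_ac)
  then show ?thesis by (simp only: binomial_fact_lemma[OF assms])
qed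

lemma Delta_inv_eq:
  assumes "m \<le> CARD('n)"
  shows "(Delta_inv m :: 'n::finite sgl) = sgl_invariant (- 1) m"
proof -
  let ?N = "CARD('n)"
  let ?T = "\<lambda>k. shifted_trace (- 1) (sgl_gen :: 'n \<Rightarrow> _) (replicate k 0)"
  have trace: "shifted_trace (- 1) (\<lambda>i j :: 'n. [:sgl_gen i j:]) (replicate k 0) = [:?T k:]" for k
  proof -
    have "shifted_trace (- 1) (\<lambda>i j :: 'n. 1 * [:sgl_gen i j:]) (replicate k 0) = 1 ^ k * [:?T k:]"
      by (rule shifted_trace_hom) (simp_all add: one_pCons mult.commute)
    then show ?thesis by simp
  qed
  define P where "P = det (mat [:0, 1:] + (\<chi> i j. [:sgl_gen i j:]) :: 'n sgl poly ^ 'n ^ 'n)"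
  have "mat [:0, 1:] + (\<chi> i j. [:sgl_gen i j:]) = ((\<chi> i j. [:sgl_gen i j:] + (if i = j then [:0, 1:] else 0))
      :: 'n sgl poly ^ 'n ^ 'n)"
    by (simp add: vec_eq_iff mat_def)
  then have expansion: "of_nat (fact ?N) * P
      = (\<Sum>k\<le>?N. of_nat ((?N choose k) * fact (?N - k)) * [:0, 1:] ^ (?N - k) * [:?T k:])"
    by (simp only: P_def det_shift_expansion trace)
  have summand: "coeff (of_nat c * [:0, 1:] ^ (?N - k) * [:x:]) (?N - m) = (if k = m then of_nat c * x else 0)"
    if "k \<in> {..?N}" for k c and x :: "'n sgl"
  proof -
    have "of_nat c * [:0, 1:] ^ (?N - k) * [:x:] = monom (of_nat c * x) (?N - k)"
      by (simp add: monom_altdef of_nat_poly mult.commute)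
    moreover have "?N - k = ?N - m \<longleftrightarrow> k = m" using that assms by auto
    ultimately show ?thesis by simp
  qed
  have "coeff (of_nat (fact ?N) * P) (?N - m)
      = (\<Sum>k\<le>?N. if k = m then of_nat ((?N choose k) * fact (?N - k)) * ?T k else 0)"
    unfolding expansion coeff_sum by (intro sum.cong refl summand)
  also have "\<dots> = of_nat (fact ?N) * sgl_invariant (- 1) m"
    using assms by (simp add: choose_fact_sgl_invariant del: of_nat_mult of_nat_fact)
  also have "coeff (of_nat (fact ?N) * P) (?N - m) = of_nat (fact ?N) * coeff P (?N - m)"
    by (simp add: of_nat_poly)
  finally show ?thesis
    unfolding Delta_inv_def P_def[symmetric] by (rule sgl_of_nat_cancel) simp
qed

lemma sgl_invariant_vanish:
  assumes "CARD('n) < m"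
  shows "(sgl_invariant (- 1) m :: 'n::finite sgl) = 0"
proof -
  have "kron (- 1) f g = 0" if "f \<in> tuples m" for f g :: "'n list"
  proof -
    have "card (set f) < length f"
      using that assms card_mono[of UNIV "set f"] by (simp add: tuples_def)
    then have "\<not> distinct f" using distinct_card by fastforce
    then show ?thesis
      using swap_covariant_not_distinct[OF swap_covariant_kron_left[of "- 1" g]] by simp
  qed
  then show ?thesis by (simp add: sgl_invariant_def shifted_trace_def)
qed

text \<open>
  Since \<open>1 - q E\<close> is the shift by \<open>1\<close> of the matrix \<open>- q E\<close>, this is \<open>det_shift_expansion\<close> once more.
\<close>

lemma Phi_det_nth: "fps_nth (Phi_det :: 'n::finite sgl fps) m = (- 1) ^ m * sgl_invariant (- 1) m"
proof -
  let ?N = "CARD('n)"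
  let ?T = "\<lambda>k. shifted_trace (- 1) (sgl_gen :: 'n \<Rightarrow> _) (replicate k 0)"
  have trace: "shifted_trace (- 1) (\<lambda>i j :: 'n. - fps_X * fps_const (sgl_gen i j)) (replicate k 0)
      = (- fps_X) ^ k * fps_const (?T k)" for k
    by (rule shifted_trace_hom) simp_all
  have "mat 1 - (\<chi> i j. fps_X * fps_const (sgl_gen i j))
      = ((\<chi> i j. - fps_X * fps_const (sgl_gen i j) + (if i = j then 1 else 0)) :: 'n sgl fps ^ 'n ^ 'n)"
    by (simp add: vec_eq_iff mat_def)
  then have expansion: "of_nat (fact ?N) * (Phi_det :: 'n sgl fps)
      = (\<Sum>k\<le>?N. of_nat ((?N choose k) * fact (?N - k)) * 1 ^ (?N - k) * ((- fps_X) ^ k * fps_const (?T k)))"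
    by (simp only: Phi_det_def det_shift_expansion trace)
  have coeff: "fps_nth (of_nat c * f) m = of_nat c * fps_nth f m" for c and f :: "'n sgl fps"
    by (simp add: fps_of_nat[symmetric])
  have power: "fps_nth ((- fps_X) ^ k * fps_const x) m = (if k = m then (- 1) ^ m * x else 0)"
    for k and x :: "'n sgl"
  proof -
    have "(- fps_X) ^ k * fps_const x = fps_const ((- 1) ^ k * x) * fps_X ^ k"
      by (subst power_minus) (simp add: mult_ac flip: fps_const_mult fps_const_power fps_const_neg)
    then show ?thesis by (auto simp: fps_X_power_iff)
  qed
  have "of_nat (fact ?N) * fps_nth (Phi_det :: 'n sgl fps) m
      = (\<Sum>k\<le>?N. if k = m then of_nat ((?N choose m) * fact (?N - m)) * ((- 1) ^ m * ?T m) else 0)"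
    unfolding coeff[symmetric] expansion fps_sum_nth power_one mult_1_right
    by (intro sum.cong refl) (simp only: coeff power, simp)
  also have "\<dots> = of_nat (fact ?N) * ((- 1) ^ m * sgl_invariant (- 1) m)"
  proof (cases "m \<le> ?N")
    case True
    then have "of_nat ((?N choose m) * fact (?N - m)) * ((- 1) ^ m * ?T m)
        = (- 1) ^ m * (of_nat (fact ?N) * sgl_invariant (- 1) m)"
      by (simp only: choose_fact_sgl_invariant[symmetric] mult.left_commute)
    with True show ?thesis by (simp add: mult.left_commute)
  qed (simp add: sgl_invariant_vanish)
  finally show ?thesis by (rule sgl_of_nat_cancel) simp
qed

text \<open>
  The Newton identities as a differential equation \<open>F' = \<eta> P F\<close> with
  \<open>P = \<Sum>\<^sub>k tr(E\<^bsup>k+1\<^esup>) q\<^sup>k\<close>. The sign \<open>\<eta>\<^sup>m\<close> is the substitution \<open>q \<mapsto> \<eta> q\<close>; it makes \<open>P\<close> the same for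
  both families.
\<close>

lemma fps_deriv_sgl_invariant:
  assumes \<eta>: "\<eta> = 1 \<or> \<eta> = - 1"
  shows "fps_deriv (Abs_fps (\<lambda>m. of_int \<eta> ^ m * sgl_invariant \<eta> m :: 'n::finite sgl))
    = fps_const (of_int \<eta>) * Abs_fps (power_sum sgl_gen sgl_gen) * Abs_fps (\<lambda>m. of_int \<eta> ^ m * sgl_invariant \<eta> m)"
proof (rule fps_ext)
  fix m
  have \<eta>2: "\<eta> * \<eta> = 1" using \<eta> by auto
  have "of_nat (Suc m) * (of_int \<eta> ^ Suc m * sgl_invariant \<eta> (Suc m) :: 'n sgl)
      = of_int \<eta> ^ Suc m * (of_nat (Suc m) * sgl_invariant \<eta> (Suc m))"
    by (rule mult.left_commute)
  also have "\<dots> = of_int \<eta> ^ Suc m * (\<Sum>k\<le>m. of_int \<eta> ^ k * power_sum sgl_gen sgl_gen k * sgl_invariant \<eta> (m - k))"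
    unfolding sgl_invariant_def
    by (subst newton_identity[where c = inv_fact, OF \<eta>2 inv_fact_Suc]) (rule refl)
  also have "\<dots> = (\<Sum>k\<le>m. of_int \<eta> * (power_sum sgl_gen sgl_gen k * (of_int \<eta> ^ (m - k) * sgl_invariant \<eta> (m - k))))"
    unfolding sum_distrib_left
  proof (intro sum.cong refl)
    fix k assume "k \<in> {..m}"
    then have "\<eta> ^ m = \<eta> ^ (m - k) * \<eta> ^ k"
      by (metis atMost_iff le_add_diff_inverse2 power_add)
    then have "\<eta> ^ Suc m * \<eta> ^ k = \<eta> * \<eta> ^ (m - k) * (\<eta> ^ k * \<eta> ^ k)"
      by (simp only: power_Suc mult_ac)
    also have "\<eta> ^ k * \<eta> ^ k = 1" by (metis \<eta>2 power_mult_distrib power_one)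
    finally have "of_int (\<eta> ^ Suc m * \<eta> ^ k) = (of_int (\<eta> * \<eta> ^ (m - k)) :: 'n sgl)"
      by (simp only: mult_1_right)
    then have "of_int \<eta> ^ Suc m * of_int \<eta> ^ k = (of_int \<eta> * of_int \<eta> ^ (m - k) :: 'n sgl)"
      by (simp only: of_int_mult of_int_power)
    moreover have "of_int \<eta> ^ Suc m * (of_int \<eta> ^ k * power_sum sgl_gen sgl_gen k * sgl_invariant \<eta> (m - k))
        = of_int \<eta> ^ Suc m * of_int \<eta> ^ k * (power_sum sgl_gen sgl_gen k * sgl_invariant \<eta> (m - k) :: 'n sgl)"
      by (simp only: mult_ac)
    ultimately show "of_int \<eta> ^ Suc m * (of_int \<eta> ^ k * power_sum sgl_gen sgl_gen k * sgl_invariant \<eta> (m - k))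
        = of_int \<eta> * (power_sum sgl_gen sgl_gen k * (of_int \<eta> ^ (m - k) * sgl_invariant \<eta> (m - k)) :: 'n sgl)"
      by (simp only: mult_ac)
  qed
  finally show "fps_nth (fps_deriv (Abs_fps (\<lambda>m. of_int \<eta> ^ m * sgl_invariant \<eta> m :: 'n sgl))) m
      = fps_nth (fps_const (of_int \<eta>) * Abs_fps (power_sum sgl_gen sgl_gen) * Abs_fps (\<lambda>m. of_int \<eta> ^ m * sgl_invariant \<eta> m)) m"
    unfolding mult.assoc fps_mult_left_const_nth
    by (simp add: fps_mult_nth atLeast0AtMost sum_distrib_left del: power_Suc of_nat_Suc)
qed

text \<open>
  MacMahon's master theorem. By the two differential equations, the product of the series for \<open>\<eta> = -1\<close>,
  which is \<open>det(1 - q E)\<close>, and the series for \<open>\<eta> = 1\<close> has derivative \<open>0\<close>, and its constant term is \<open>1\<close>.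
\<close>

lemma Phi_inv_eq: "(Phi_inv m :: 'n::finite sgl) = sgl_invariant 1 m"
proof -
  define D where "D = Abs_fps (\<lambda>m. of_int (- 1) ^ m * sgl_invariant (- 1) m :: 'n sgl)"
  define G where "G = Abs_fps (\<lambda>m. of_int 1 ^ m * sgl_invariant 1 m :: 'n sgl)"
  have D: "D = Phi_det" by (rule fps_ext) (simp add: D_def Phi_det_nth)
  define p where "p = Abs_fps (power_sum sgl_gen (sgl_gen :: 'n \<Rightarrow> _))"
  have "fps_deriv D = fps_const (of_int (- 1)) * p * D" and G: "fps_deriv G = fps_const (of_int 1) * p * G"
    unfolding D_def G_def p_def by (rule fps_deriv_sgl_invariant; simp)+
  moreover have "fps_const (of_int (- 1)) = (- 1 :: 'n sgl fps)"
    by (simp flip: fps_const_neg)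
  ultimately have "fps_deriv D = - (p * D)"
    by (simp only: mult_minus_left mult_1_left)
  then have "fps_deriv (D * G) = 0"
    using G by (simp add: algebra_simps)
  then have zero: "fps_nth (D * G) (Suc n) = 0" for n
    by (metis (no_types, lifting) Suc_eq_plus1 fps_deriv_nth fps_zero_nth mult_zero_right nat.distinct(1) sgl_of_nat_cancel)
  have "D * G = 1"
  proof (rule fps_ext)
    fix n
    show "fps_nth (D * G) n = fps_nth 1 n"
      using zero by (cases n) (simp_all add: D_def G_def sgl_invariant_0)
  qed
  then have "Phi_series = D * G * Phi_series" by simp
  also have "\<dots> = G * (Phi_det * Phi_series)" unfolding D by (simp only: mult_ac)
  also have "\<dots> = G" by (simp add: Phi_series_inverse)
  finally have "Phi_series = G" .
  then have "(Phi_inv m :: 'n sgl) = fps_nth G m" unfolding Phi_inv_def by (rule arg_cong)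
  then show ?thesis by (simp add: G_def)
qed

section \<open>Symmetrization of traces\<close>

lemma symmetrization_add: "symmetrization (p + q) = symmetrization p + symmetrization q"
proof -
  define S where "S M = symmetrized_product (SOME xs. mset xs = M)" for M :: "('a \<times> 'a) multiset"
  have superset: "symmetrization r = (\<Sum>M\<in>A. ugl_const (Poly_Mapping.lookup r M) * S M)"
    if "finite A" "Poly_Mapping.keys r \<subseteq> A" for r :: "'a sgl" and A
    unfolding symmetrization_def S_def using that
    by (intro sum.mono_neutral_left) (auto simp: in_keys_iff ugl_const_0)
  let ?A = "Poly_Mapping.keys p \<union> Poly_Mapping.keys q"
  have "Poly_Mapping.keys (p + q) \<subseteq> ?A" by (rule Poly_Mapping.keys_add)
  then show ?thesis
    by (simp add: superset[of ?A] lookup_add ugl_const_add distrib_right sum.distrib)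
qed

lemma symmetrization_scale: "symmetrization (sgl_const c * p) = ugl_const c * symmetrization p"
proof (cases "c = 0")
  case False
  have lookup: "Poly_Mapping.lookup (sgl_const c * p) M = c * Poly_Mapping.lookup p M" for M
    by (induction p rule: poly_mapping_single_induct)
      (simp_all add: sgl_const_def distrib_left lookup_add mult_single lookup_single when_def)
  then have "Poly_Mapping.keys (sgl_const c * p) = Poly_Mapping.keys p"
    using False by (auto simp: in_keys_iff)
  then show ?thesis
    by (simp add: symmetrization_def lookup ugl_const_mult sum_distrib_left mult.assoc)
qed (simp add: sgl_const_def ugl_const_0 symmetrization_def)

lemma symmetrization_sum: "symmetrization (\<Sum>x\<in>A. F x) = (\<Sum>x\<in>A. symmetrization (F x))"
  by (induction A rule: infinite_finite_induct)
    (simp_all add: symmetrization_add, simp_all add: symmetrization_def)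

lemma sum_permute_list:
  fixes F :: "'b::finite list \<Rightarrow> 'c::comm_monoid_add"
  assumes \<sigma>: "\<sigma> permutes {..<m}"
  shows "(\<Sum>zs\<in>tuples m. F (permute_list \<sigma> zs)) = (\<Sum>zs\<in>tuples m. F zs)"
proof (rule sum.reindex_bij_witness[of _ "permute_list (inv \<sigma>)" "permute_list \<sigma>"])
  fix zs :: "'b list"
  assume "zs \<in> tuples m"
  then have len: "length zs = m" by (simp add: tuples_def)
  have "permute_list (inv \<sigma>) (permute_list \<sigma> zs) = permute_list (\<sigma> \<circ> inv \<sigma>) zs"
    using len permutes_inv[OF \<sigma>] by (simp add: permute_list_compose)
  then show "permute_list (inv \<sigma>) (permute_list \<sigma> zs) = zs"
    using \<sigma> by (simp add: permutes_inv_o)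
  have "permute_list \<sigma> (permute_list (inv \<sigma>) zs) = permute_list (inv \<sigma> \<circ> \<sigma>) zs"
    using len \<sigma> by (simp add: permute_list_compose)
  then show "permute_list \<sigma> (permute_list (inv \<sigma>) zs) = zs"
    using \<sigma> by (simp add: permutes_inv_o)
qed (simp_all add: tuples_def)

text \<open>
  The coefficients \<open>kron\<close> do not change when both words are permuted simultaneously. So all
  orderings of the factors contribute the same sum, and symmetrization merely reads the commutative
  trace as a noncommutative one.
\<close>

lemma symmetrization_shifted_trace:
  assumes \<eta>: "\<eta> * \<eta> = 1"
  shows "symmetrization (shifted_trace \<eta> sgl_gen (replicate m 0)) = shifted_trace \<eta> (ugl_gen :: 'n::finite \<Rightarrow> _) (replicate m 0)"
proof -
  define \<kappa> where "\<kappa> zs = kron \<eta> (map fst zs) (map snd zs)" for zs :: "('n \<times> 'n) list"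
  define P where "P zs = prod_list (map (\<lambda>(i, j). ugl_gen i j) zs)" for zs :: "('n \<times> 'n) list"
  have \<kappa>: "\<kappa> (permute_list \<sigma> zs) = \<kappa> zs" if "\<sigma> permutes {..<length zs}" for \<sigma> zs
  proof (rule swap_invariant_mset_eq)
    fix k a b l
    have "\<kappa> (k @ a # b # l) = \<eta> * (\<eta> * \<kappa> (k @ b # a # l))"
      using swap_covariantD[OF swap_covariant_kron_left[OF \<eta>, of "map snd (k @ a # b # l)"],
          of "map fst k" "fst a" "fst b" "map fst l"]
        swap_covariantD[OF swap_covariant_kron_right[OF \<eta>, of "map fst (k @ b # a # l)"],
          of "map snd k" "snd a" "snd b" "map snd l"]
      by (simp add: \<kappa>_def)
    then show "\<kappa> (k @ a # b # l) = \<kappa> (k @ b # a # l)"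
      by (metis \<eta> mult.assoc mult_1_left)
  qed (use that in simp)
  have pairs: "shifted_trace \<eta> X (replicate m 0)
      = (\<Sum>zs\<in>tuples m. of_int (\<kappa> zs) * prod_list (map (\<lambda>(i, j). X i j) zs))"
    for X :: "'n \<Rightarrow> 'n \<Rightarrow> 'c::ring_1"
    unfolding shifted_trace_def length_replicate sum_tuples_pairs
    by (intro sum.cong refl) (simp add: tuples_def word_unshifted \<kappa>_def)
  have "symmetrization (shifted_trace \<eta> sgl_gen (replicate m 0))
      = (\<Sum>zs\<in>tuples m. of_int (\<kappa> zs) * symmetrized_product zs)"
    unfolding pairs symmetrization_sum sgl_const_of_int[symmetric] symmetrization_scale
      symmetrization_prod_list ugl_const_of_int ..
  also have "\<dots> = (\<Sum>zs\<in>tuples m. ugl_const (1 / fact m)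
      * (\<Sum>\<sigma> | \<sigma> permutes {..<m}. of_int (\<kappa> (permute_list \<sigma> zs)) * P (permute_list \<sigma> zs)))"
  proof (intro sum.cong refl)
    fix zs :: "('n \<times> 'n) list"
    assume "zs \<in> tuples m"
    then have len: "length zs = m" by (simp add: tuples_def)
    have "of_int (\<kappa> zs) * symmetrized_product zs
        = ugl_const (1 / fact m) * (\<Sum>\<sigma> | \<sigma> permutes {..<m}. of_int (\<kappa> zs) * P (permute_list \<sigma> zs))"
    proof -
      have pull: "of_int z * (ugl_const c * y) = ugl_const c * (of_int z * y)" for z c and y :: "'n ugl"
        by (metis mult.assoc ugl_const_central)
      show ?thesis
        by (simp only: symmetrized_product_def len P_def pull sum_distrib_left)
    qed
    then show "of_int (\<kappa> zs) * symmetrized_product zs = ugl_const (1 / fact m)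
      * (\<Sum>\<sigma> | \<sigma> permutes {..<m}. of_int (\<kappa> (permute_list \<sigma> zs)) * P (permute_list \<sigma> zs))"
      using \<kappa>[of _ zs] len by simp
  qed
  also have "\<dots> = ugl_const (1 / fact m) * (\<Sum>\<sigma> | \<sigma> permutes {..<m}. \<Sum>zs\<in>tuples m.
      of_int (\<kappa> (permute_list \<sigma> zs)) * P (permute_list \<sigma> zs))"
    unfolding sum_distrib_left[symmetric] by (subst sum.swap) (rule refl)
  also have "\<dots> = ugl_const (1 / fact m) * (\<Sum>\<sigma> | \<sigma> permutes {..<m}. \<Sum>zs\<in>tuples m. of_int (\<kappa> zs) * P zs)"
    by (simp add: sum_permute_list[where F = "\<lambda>zs. of_int (\<kappa> zs) * P zs"] cong: sum.cong_simp)
  also have "\<dots> = ugl_const (1 / fact m) * of_nat (fact m) * (\<Sum>zs\<in>tuples m. of_int (\<kappa> zs) * P zs)"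
    by (simp add: card_permutations[of "{..<m}" m] mult.assoc)
  also have "ugl_const (1 / fact m) * of_nat (fact m) = (ugl_const (1 / fact m * of_nat (fact m)) :: 'n ugl)"
    by (simp only: ugl_const_mult ugl_const_of_nat)
  also have "\<dots> = 1" by (simp add: ugl_const_1)
  finally show ?thesis by (simp add: pairs P_def)
qed

lemma symmetrization_sgl_invariant:
  assumes "\<eta> * \<eta> = 1"
  shows "symmetrization (sgl_invariant \<eta> m :: 'n::finite sgl)
    = ugl_const (1 / fact m) * shifted_trace \<eta> ugl_gen (replicate m 0)"
  by (simp add: sgl_invariant_def symmetrization_scale symmetrization_shifted_trace[OF assms])

section \<open>Harish-Chandra images\<close>

context irreducible_highest_weight_module
begin

text \<open>
  The Harish-Chandra images of both families at once: the scalar by which a central element acts can be read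
  off from \<open>\<xi>\<close>, where the Stirling expansion into Capelli elements is known.
\<close>

lemma act_symmetrization_sgl_invariant:
  assumes \<eta>: "\<eta> = 1 \<or> \<eta> = - 1"
  shows "act (symmetrization (sgl_invariant \<eta> m)) v
    = scale (\<Sum>k\<le>m. of_nat (Stirling m k) * (- of_int \<eta>) ^ (m - k)
        * (\<Prod>r\<in>{k..<m}. of_nat CARD('n) + of_int \<eta> * of_nat r) * (fact k / fact m)
        * (\<Sum>s | length s = k \<and> sorted s \<and> (\<eta> = 1 \<or> distinct s).
            \<Prod>r<k. weight $ (s ! r) + of_int \<eta> * of_nat r)) v"
    (is "_ = scale (\<Sum>k\<le>m. ?c k * (fact k / fact m) * ?s k) v")
proof (rule act_central_scalar)
  have \<eta>2: "\<eta> * \<eta> = 1" using \<eta> by auto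
  show "ugl_gen i j * symmetrization (sgl_invariant \<eta> m) = symmetrization (sgl_invariant \<eta> m) * ugl_gen i j"
    for i j
    unfolding symmetrization_sgl_invariant[OF \<eta>2]
    by (metis mult.assoc shifted_trace_commute[OF gl_relations_ugl_gen] ugl_const_central)
  have "act (shifted_trace \<eta> ugl_gen (replicate m 0)) \<xi>
      = (\<Sum>k\<le>m. act (of_int (int (Stirling m k) * (- \<eta>) ^ (m - k)
          * (\<Prod>r\<in>{k..<m}. int CARD('n) + \<eta> * int r)))
        (act (shifted_trace \<eta> ugl_gen (capelli_shifts \<eta> k)) \<xi>))"
    unfolding shifted_trace_unshifted[OF \<eta>2] act_sum act_mult capelli_shifts_def ..
  also have "\<dots> = (\<Sum>k\<le>m. scale (?c k * (fact k * ?s k)) \<xi>)"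
    unfolding act_of_int act_shifted_trace[OF \<eta>] by simp
  finally have "act (shifted_trace \<eta> ugl_gen (replicate m 0)) \<xi> = (\<Sum>k\<le>m. scale (?c k * (fact k * ?s k)) \<xi>)" .
  then show "act (symmetrization (sgl_invariant \<eta> m)) \<xi>
      = scale (\<Sum>k\<le>m. ?c k * (fact k / fact m) * ?s k) \<xi>"
    by (simp add: symmetrization_sgl_invariant[OF \<eta>2] act_mult act_const scale_sum_left scale_sum_right mult_ac)
qed

end

text \<open>
  The quotient of the binomial coefficients in the final formulas, in the form in which the
  partial traces produce it.
\<close>

lemma gbinomial_ratio:
  fixes a :: complex
  assumes "k \<le> m" "a gchoose k \<noteq> 0"
  shows "(a gchoose m) * inverse (a gchoose k) = (\<Prod>r\<in>{k..<m}. a - of_nat r) * (fact k / fact m)"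
proof -
  have "(\<Prod>r\<in>{0..<m}. a - of_nat r) = (\<Prod>r\<in>{0..<k}. a - of_nat r) * (\<Prod>r\<in>{k..<m}. a - of_nat r)"
    using assms(1) by (simp add: prod.atLeastLessThan_concat)
  with assms(2) show ?thesis by (simp add: gbinomial_prod_rev field_simps)
qed

theorem theorem3p1:
  fixes lam :: "complex ^ 'n::{finite,linorder}"
    and scale :: "complex \<Rightarrow> 'v::ab_group_add \<Rightarrow> 'v"
    and act :: "'n ugl \<Rightarrow> 'v \<Rightarrow> 'v"
    and \<xi> :: 'v
  assumes L: "irreducible_highest_weight_module scale act lam \<xi>"
  shows "(\<forall>m\<in>{1..CARD('n)}. \<forall>v. act (symmetrization (Delta_inv m)) v =
            scale (\<Sum>k=1..m. of_nat (Stirling m k) * (of_nat CARD('n) gchoose m)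
              * inverse (of_nat CARD('n) gchoose k) * shifted_elementary k lam) v)
       \<and> (\<forall>m\<ge>1. \<forall>v. act (symmetrization (Phi_inv m)) v =
            scale (\<Sum>k=1..m. of_nat (Stirling m k) * (- of_nat CARD('n) gchoose m)
              * inverse (- of_nat CARD('n) gchoose k) * shifted_complete k lam) v)"
proof (intro conjI ballI allI impI)
  interpret irreducible_highest_weight_module scale act lam \<xi> by (rule L)
  let ?N = "of_nat CARD('n) :: complex"
  \<comment> \<open>The sums over \<open>k\<close> may start at \<open>1\<close>, as \<open>Stirling m 0 = 0\<close> for \<open>m \<ge> 1\<close>.\<close>
  have drop0: "(\<Sum>k\<le>m. F k) = (\<Sum>k=1..m. F k)" if "F 0 = 0" for F :: "nat \<Rightarrow> complex" and m
    using that by (simp add: sum.atMost_shift sum.atLeast1_atMost_eq)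
  have stirling0: "Stirling m 0 = 0" if "1 \<le> m" for m
    using that by (cases m) auto
  {
    fix m v
    assume m: "m \<in> {1..CARD('n)}"
    have "of_nat (Stirling m k) * (- of_int (- 1)) ^ (m - k)
        * (\<Prod>r\<in>{k..<m}. ?N + of_int (- 1) * of_nat r) * (fact k / fact m)
        * (\<Sum>s | length s = k \<and> sorted s \<and> ((- 1 :: int) = 1 \<or> distinct s).
            \<Prod>r<k. lam $ (s ! r) + of_int (- 1) * of_nat r)
      = of_nat (Stirling m k) * (?N gchoose m) * inverse (?N gchoose k) * shifted_elementary k lam"
      if "k \<in> {1..m}" for k
    proof -
      \<comment> \<open>The binomial coefficient does not vanish since \<open>k \<le> m \<le> N\<close>.\<close>
      have "?N gchoose k \<noteq> 0"
        using that m by (simp flip: binomial_gbinomial)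
      then have "(?N gchoose m) * inverse (?N gchoose k) = (\<Prod>r\<in>{k..<m}. ?N - of_nat r) * (fact k / fact m)"
        using that by (intro gbinomial_ratio) auto
      then show ?thesis
        by (simp add: shifted_elementary_def strict_sorted_iff mult.assoc)
    qed
    then show "act (symmetrization (Delta_inv m)) v =
            scale (\<Sum>k=1..m. of_nat (Stirling m k) * (of_nat CARD('n) gchoose m)
              * inverse (of_nat CARD('n) gchoose k) * shifted_elementary k lam) v"
      using m by (simp add: Delta_inv_eq act_symmetrization_sgl_invariant drop0 stirling0)
  next
    fix m :: nat and v
    assume m: "1 \<le> m"
    have "of_nat (Stirling m k) * (- of_int 1) ^ (m - k)
        * (\<Prod>r\<in>{k..<m}. ?N + of_int 1 * of_nat r) * (fact k / fact m)
        * (\<Sum>s | length s = k \<and> sorted s \<and> ((1 :: int) = 1 \<or> distinct s).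
            \<Prod>r<k. lam $ (s ! r) + of_int 1 * of_nat r)
      = of_nat (Stirling m k) * (- ?N gchoose m) * inverse (- ?N gchoose k) * shifted_complete k lam"
      if "k \<in> {1..m}" for k
    proof -
      \<comment> \<open>A binomial coefficient of \<open>-N\<close> never vanishes.\<close>
      have "- ?N - of_nat r \<noteq> 0" for r
      proof -
        have "- ?N - of_nat r = - of_nat (CARD('n) + r)" by simp
        then show ?thesis by (simp del: of_nat_add)
      qed
      then have "- ?N gchoose k \<noteq> 0"
        by (simp add: gbinomial_prod_rev)
      then have "(- ?N gchoose m) * inverse (- ?N gchoose k) = (\<Prod>r\<in>{k..<m}. - ?N - of_nat r) * (fact k / fact m)"
        using that by (intro gbinomial_ratio) auto
      also have "(\<Prod>r\<in>{k..<m}. - ?N - of_nat r) = (\<Prod>r\<in>{k..<m}. - 1 * (?N + of_nat r))"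
        by simp
      also have "\<dots> = (- 1) ^ (m - k) * (\<Prod>r\<in>{k..<m}. ?N + of_nat r)"
        by (subst prod.distrib) simp
      finally show ?thesis
        by (simp add: shifted_complete_def mult.assoc)
    qed
    then show "act (symmetrization (Phi_inv m)) v =
            scale (\<Sum>k=1..m. of_nat (Stirling m k) * (- of_nat CARD('n) gchoose m)
              * inverse (- of_nat CARD('n) gchoose k) * shifted_complete k lam) v"
      using m by (simp add: Phi_inv_eq act_symmetrization_sgl_invariant drop0 stirling0)
  }
qed

end
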